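(* Let $s_f>0$, $I=[0,s_f]$, let $\mu^-,\alpha^+,\alpha^-\in L^\infty(I)$ with $\mu^-\ge 0$, $\alpha^+\ge 0$, $\alpha^-\le 0$, let $\mu^+\in\mathcal Q$, and let $\Psi:W^{1,\infty}(I)\to\mathbb R$ be order reversing (that is, $x\ge y$ implies $\Psi(x)\le\Psi(y)$). Consider the problem $$\text{(P)}\qquad \min_{w\in W^{1,\infty}(I)}\Psi(w)\quad\text{subject to}\quad \mu^-(s)\le w(s)\le\mu^+(s)\ \ (s\in I),\qquad \alpha^-(s)\le w'(s)\le\alpha^+(s)\ \ (\text{a.e. } s\in I).$$ Let $w^*=M(\mu^+)=F(\mu^+)\wedge B(\mu^+)$. Then: (i) Problem (P) is feasible (i.e. some $w\in W^{1,\infty}(I)$ satisfies all its constraints) if and only if $w^*\ge\mu^-$ on $I$. (ii) If problem (P) is feasible, then $w^*$ is an optimal solution of it: $w^*$ satisfies the constraints and $\Psi(w^* )\le\Psi(w)$ for every feasible $w$.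
   Context: Elements of $W^{1,\infty}(I)$ (functions in $L^\infty(I)$ with weak derivative in $L^\infty(I)$) are identified with their Lipschitz continuous representatives. $\mu^-$ is a genuine function on $I$; $f\le g$ means $f(x)\le g(x)$ for all $x\in I$; $\wedge,\vee$ denote pointwise minimum and maximum. The sign conditions on $\alpha^\pm$ hold a.e. $\mathrm{sign}(x)=1,0,-1$ according to $x>0$, $x=0$, $x<0$. $\mathcal Q$ is the set of $\mu\in W^{1,\infty}(I)$ such that $\mathrm{sign}(\mu'-\alpha^+)$ and $\mathrm{sign}(\mu'-\alpha^-)$ are Riemann integrable on $I$ (equivalently, being bounded, a.e. continuous). Forward operator $F:\mathcal Q\to W^{1,\infty}(I)$: $F(\mu)=\phi$ is the unique (absolutely continuous) solution, with the equation holding for a.e. $x\in I$, of $$\phi'(x)=\begin{cases}\alpha^+(x)\wedge\mu'(x)&\text{if }\phi(x)\ge\mu(x)\\ \alpha^+(x)&\text{if }\phi(x)<\mu(x)\end{cases},\qquad \phi(0)=\mu(0).$$ Backward operator $B:\mathcal Q\to W^{1,\infty}(I)$: $B(\mu)=\phi$ is the unique (absolutely continuous) solution, with the equation holding for a.e. $x\in I$, of $$\phi'(x)=\begin{cases}\alpha^-(x)\vee\mu'(x)&\text{if }\phi(x)\ge\mu(x)\\ \alpha^-(x)&\text{if }\phi(x)<\mu(x)\end{cases},\qquad \phi(s_f)=\mu(s_f).$$ Existence and uniqueness of these solutions are known for $\mu\in\mathcal Q$. Meet operator: $M(\mu)=F(\mu)\wedge B(\mu)$. *)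

theory Defs
  imports "HOL-Analysis.Analysis"
begin

text \<open>
  A function on \<open>I = [0, s]\<close> is a total function \<open>real \<Rightarrow> real\<close> of which only the values on
  \<open>{0..s}\<close> matter; all notions below ignore what happens outside this interval.
\<close>

definition Linf :: "real \<Rightarrow> (real \<Rightarrow> real) set" where
  "Linf s = {f. f \<in> borel_measurable (lebesgue_on {0..s}) \<and>
                (\<exists>C. AE x in lebesgue_on {0..s}. \<bar>f x\<bar> \<le> C)}"

text \<open>The space of test functions \<open>C\<^sub>c\<^sup>\<infinity>(0, s)\<close>.\<close>

definition test_funs :: "real \<Rightarrow> (real \<Rightarrow> real) set" where
  "test_funs s = {\<phi>. (\<forall>n x. (deriv ^^ n) \<phi> differentiable (at x)) \<and>
                     (\<exists>a b. 0 < a \<and> b < s \<and> (\<forall>x. x \<notin> {a..b} \<longrightarrow> \<phi> x = 0))}"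

definition has_weak_deriv :: "real \<Rightarrow> (real \<Rightarrow> real) \<Rightarrow> (real \<Rightarrow> real) \<Rightarrow> bool" where
  "has_weak_deriv s f g \<longleftrightarrow>
     (\<forall>\<phi>\<in>test_funs s. (LINT x|lebesgue_on {0..s}. f x * deriv \<phi> x)
                       = - (LINT x|lebesgue_on {0..s}. g x * \<phi> x))"

text \<open>
  \<open>W\<^sup>1\<^sup>,\<^sup>\<infinity>(I)\<close>, each element being represented by its Lipschitz continuous representative.
\<close>

definition W1inf :: "real \<Rightarrow> (real \<Rightarrow> real) set" where
  "W1inf s = {f. f \<in> Linf s \<and> (\<exists>g\<in>Linf s. has_weak_deriv s f g) \<and>
                 (\<exists>L. L-lipschitz_on {0..s} f)}"

text \<open>
  A representative of the weak derivative, which is determined only up to a null set; it is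
  therefore used below only inside almost-everywhere statements.
\<close>

definition wderiv :: "real \<Rightarrow> (real \<Rightarrow> real) \<Rightarrow> real \<Rightarrow> real" where
  "wderiv s f = (SOME g. g \<in> Linf s \<and> has_weak_deriv s f g)"

text \<open>
  Riemann integrability on \<open>[0, s]\<close>: Riemann sums over tagged partitions converge as the mesh
  tends to 0, i.e. the Henstock-Kurzweil condition restricted to constant gauges.
\<close>

definition riemann_integrable :: "real \<Rightarrow> (real \<Rightarrow> real) \<Rightarrow> bool" where
  "riemann_integrable s f \<longleftrightarrow>
     (\<exists>J. \<forall>\<epsilon>>0. \<exists>\<delta>>0. \<forall>p. p tagged_division_of {0..s} \<and> (\<lambda>x. ball x \<delta>) fine p \<longrightarrow>
        \<bar>(\<Sum>(x, K)\<in>p. measure lborel K * f x) - J\<bar> < \<epsilon>)"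

text \<open>
  The functions \<open>sgn (\<mu>' - \<alpha>\<^sup>\<plusminus>)\<close> are defined only almost everywhere, whereas Riemann integrability
  depends on pointwise values; the condition on such a class is that it has a Riemann integrable
  representative.
\<close>

definition Q_set :: "real \<Rightarrow> (real \<Rightarrow> real) \<Rightarrow> (real \<Rightarrow> real) \<Rightarrow> (real \<Rightarrow> real) set" where
  "Q_set s \<alpha>p \<alpha>m = {\<mu>\<in>W1inf s.
     (\<exists>r. riemann_integrable s r \<and>
          (AE x in lebesgue_on {0..s}. r x = sgn (wderiv s \<mu> x - \<alpha>p x))) \<and>
     (\<exists>r. riemann_integrable s r \<and>
          (AE x in lebesgue_on {0..s}. r x = sgn (wderiv s \<mu> x - \<alpha>m x)))}"

text \<open>
  The right-hand sides below are essentially bounded, so every absolutely continuous solution is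
  Lipschitz; hence solutions are sought directly in \<open>W\<^sup>1\<^sup>,\<^sup>\<infinity>(I)\<close>.
\<close>

definition forward_solution ::
    "real \<Rightarrow> (real \<Rightarrow> real) \<Rightarrow> (real \<Rightarrow> real) \<Rightarrow> (real \<Rightarrow> real) \<Rightarrow> bool" where
  "forward_solution s \<alpha>p \<mu> \<phi> \<longleftrightarrow> \<phi> \<in> W1inf s \<and>
     (AE x in lebesgue_on {0..s}.
        wderiv s \<phi> x = (if \<phi> x \<ge> \<mu> x then min (\<alpha>p x) (wderiv s \<mu> x) else \<alpha>p x)) \<and>
     \<phi> 0 = \<mu> 0"

definition backward_solution ::
    "real \<Rightarrow> (real \<Rightarrow> real) \<Rightarrow> (real \<Rightarrow> real) \<Rightarrow> (real \<Rightarrow> real) \<Rightarrow> bool" where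
  "backward_solution s \<alpha>m \<mu> \<phi> \<longleftrightarrow> \<phi> \<in> W1inf s \<and>
     (AE x in lebesgue_on {0..s}.
        wderiv s \<phi> x = (if \<phi> x \<ge> \<mu> x then max (\<alpha>m x) (wderiv s \<mu> x) else \<alpha>m x)) \<and>
     \<phi> s = \<mu> s"

text \<open>
  \<open>SOME\<close> rather than \<open>THE\<close>, because the solutions are unique only as functions on \<open>{0..s}\<close>.
\<close>

definition forward_op :: "real \<Rightarrow> (real \<Rightarrow> real) \<Rightarrow> (real \<Rightarrow> real) \<Rightarrow> real \<Rightarrow> real" where
  "forward_op s \<alpha>p \<mu> = (SOME \<phi>. forward_solution s \<alpha>p \<mu> \<phi>)"

definition backward_op :: "real \<Rightarrow> (real \<Rightarrow> real) \<Rightarrow> (real \<Rightarrow> real) \<Rightarrow> real \<Rightarrow> real" where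
  "backward_op s \<alpha>m \<mu> = (SOME \<phi>. backward_solution s \<alpha>m \<mu> \<phi>)"

definition meet_op ::
    "real \<Rightarrow> (real \<Rightarrow> real) \<Rightarrow> (real \<Rightarrow> real) \<Rightarrow> (real \<Rightarrow> real) \<Rightarrow> real \<Rightarrow> real" where
  "meet_op s \<alpha>p \<alpha>m \<mu> = (\<lambda>x. min (forward_op s \<alpha>p \<mu> x) (backward_op s \<alpha>m \<mu> x))"

text \<open>
  Applied in both directions, this forces \<open>\<Psi>\<close> to agree on functions that coincide on \<open>{0..s}\<close>,
  so that it is indeed a functional on \<open>W\<^sup>1\<^sup>,\<^sup>\<infinity>(I)\<close>.
\<close>

definition order_reversing :: "real \<Rightarrow> ((real \<Rightarrow> real) \<Rightarrow> real) \<Rightarrow> bool" where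
  "order_reversing s \<Psi> \<longleftrightarrow>
     (\<forall>u\<in>W1inf s. \<forall>v\<in>W1inf s. (\<forall>x\<in>{0..s}. v x \<le> u x) \<longrightarrow> \<Psi> u \<le> \<Psi> v)"

definition feasible ::
    "real \<Rightarrow> (real \<Rightarrow> real) \<Rightarrow> (real \<Rightarrow> real) \<Rightarrow> (real \<Rightarrow> real) \<Rightarrow> (real \<Rightarrow> real) \<Rightarrow>
     (real \<Rightarrow> real) \<Rightarrow> bool" where
  "feasible s \<mu>m \<mu>p \<alpha>m \<alpha>p w \<longleftrightarrow> w \<in> W1inf s \<and>
     (\<forall>x\<in>{0..s}. \<mu>m x \<le> w x \<and> w x \<le> \<mu>p x) \<and>
     (AE x in lebesgue_on {0..s}. \<alpha>m x \<le> wderiv s w x \<and> wderiv s w x \<le> \<alpha>p x)"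

end

theory Submission
  imports Defs
begin

text \<open>
  The two differential equations describe extremal functions, and this makes the meet an upper bound
  for all feasible functions.
  Every solution \<open>\<phi>\<close> of the forward equation stays below \<open>\<mu>\<close>, because where it is above, \<open>\<phi> - \<mu>\<close> does not
  increase, and they start equal. It is also the largest function below \<open>\<mu>\<close> whose slope never
  exceeds \<open>\<alpha>\<^sup>+\<close>: where a competitor \<open>w \<le> \<mu>\<close> is above \<open>\<phi>\<close>, the solution is strictly below \<open>\<mu>\<close>, hence
  climbs at the full rate \<open>\<alpha>\<^sup>+ \<ge> w'\<close>, so that \<open>w - \<phi>\<close> cannot become positive
  (\<open>nonpos_if_ae_deriv_nonpos_where_pos\<close>, \<open>forward_solution_greatest\<close>). The reflection
  \<open>x \<mapsto> s - x\<close> exchanges the two equations, so the backward solution is the largest function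
  below \<open>\<mu>\<close> whose slope is at least \<open>\<alpha>\<^sup>-\<close>. Consequently every feasible \<open>w\<close> lies below the meet, and once
  the meet is known to be feasible both parts of the theorem follow, \<open>\<Psi>\<close> being order reversing.

  The meet satisfies both slope constraints at almost every point (\<open>meet_ae_deriv_between\<close>). Where the
  forward solution is the smaller one it is strictly below \<open>\<mu>\<close>, so the meet has slope
  \<open>\<alpha>\<^sup>+ \<ge> 0 \<ge> \<alpha>\<^sup>-\<close>; where the backward solution is the smaller one the slope is \<open>\<alpha>\<^sup>- \<le> 0 \<le> \<alpha>\<^sup>+\<close>; and where
  they coincide, their derivatives agree almost everywhere, so each supplies one of the two bounds.

  The operators are defined by choice, so solutions have to be produced. With \<open>A x = \<integral>\<^sub>0\<^sup>x \<alpha>\<^sup>+\<close>, subtracting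
  \<open>A\<close> turns ``largest function below \<open>\<mu>\<close> with slope at most \<open>\<alpha>\<^sup>+\<close>'' into ``largest nonincreasing function below
  \<open>\<mu> - A\<close>'', which is the running minimum; so \<open>\<phi> = A + min\<^bsub>[0,x]\<^esub> (\<mu> - A)\<close> is a solution
  (\<open>ae_deriv_running_min\<close>, \<open>forward_solution_exists\<close>).

  All of this takes place with derivatives that exist almost everywhere, whereas \<open>W\<^sup>1\<^sup>,\<^sup>\<infinity>\<close> speaks of test
  functions. The bridge is that, for a Lipschitz function, the weak derivative is the derivative
  almost everywhere, and conversely (\<open>W1inf_imp_ae_deriv\<close>, \<open>ae_deriv_imp_W1inf\<close>). It rests on the
  Lebesgue differentiation theorem for bounded functions, on the fundamental theorem of calculus for
  Lipschitz functions, and on a du Bois-Reymond lemma.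
\<close>


section \<open>Lebesgue differentiation for bounded functions\<close>

lemma bounded_measurable_absolutely_integrable:
  fixes h :: "real \<Rightarrow> real"
  assumes "h \<in> borel_measurable lebesgue" "\<And>x. \<bar>h x\<bar> \<le> C" "S \<in> lmeasurable"
  shows "h absolutely_integrable_on S"
proof (rule measurable_bounded_by_integrable_imp_absolutely_integrable)
  show "h \<in> borel_measurable (lebesgue_on S)"
    using assms(1) by (rule measurable_restrict_space1)
  show "(\<lambda>x. C) integrable_on S"
    using assms(3) by (simp add: integrable_on_const)
qed (use assms in auto)

lemma integral_nonneg_disjoint_UN:
  fixes h :: "real \<Rightarrow> real" and F :: "nat \<Rightarrow> real set"
  assumes h: "h absolutely_integrable_on (\<Union>i. F i)"
    and F: "\<And>i. F i \<in> lmeasurable"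
    and disj: "\<And>i j. i \<noteq> j \<Longrightarrow> F i \<inter> F j = {}"
    and nonneg: "\<And>i. 0 \<le> integral (F i) h"
  shows "0 \<le> integral (\<Union>i. F i) h"
proof -
  have sub: "h absolutely_integrable_on S" if "S \<subseteq> (\<Union>i. F i)" "S \<in> sets lebesgue" for S
    using set_integrable_subset[OF h that(2,1)] .
  have UN: "(\<Union>m\<le>n. F m) \<in> sets lebesgue" for n
    by (intro sets.finite_UN fmeasurableD F) simp
  have "0 \<le> integral (\<Union>m\<le>n. F m) h" for n
  proof (induction n)
    case (Suc n)
    have "integral ((\<Union>m\<le>n. F m) \<union> F (Suc n)) h = integral (\<Union>m\<le>n. F m) h + integral (F (Suc n)) h"
    proof (rule integral_Un)
      show "h integrable_on (\<Union>m\<le>n. F m)"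
        by (rule set_lebesgue_integral_eq_integral(1)[OF sub[OF UN_mono UN]]) auto
      show "h integrable_on F (Suc n)"
        by (rule set_lebesgue_integral_eq_integral(1)[OF sub[OF UN_upper fmeasurableD[OF F]]]) simp
      have "(\<Union>m\<le>n. F m) \<inter> F (Suc n) = {}"
      proof -
        have "F m \<inter> F (Suc n) = {}" if "m \<le> n" for m
          using that by (intro disj) simp
        then show ?thesis by blast
      qed
      then show "negligible ((\<Union>m\<le>n. F m) \<inter> F (Suc n))"
        by simp
    qed
    moreover have "(\<Union>m\<le>Suc n. F m) = (\<Union>m\<le>n. F m) \<union> F (Suc n)"
      by (auto simp: atMost_Suc)
    ultimately show ?case
      using Suc nonneg[of "Suc n"] by simp
  qed (use nonneg in simp)
  moreover have "(\<lambda>n. integral (\<Union>m\<le>n. F m) h) \<longlonglongrightarrow> integral (\<Union>i. F i) h"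
  proof -
    have U: "(\<Union>n. \<Union>m\<le>n. F m) = (\<Union>i. F i)" by auto
    have "(\<lambda>n. LINT x:(\<Union>m\<le>n. F m)|lebesgue. h x) \<longlonglongrightarrow> (LINT x:(\<Union>n. \<Union>m\<le>n. F m)|lebesgue. h x)"
    proof (rule set_integral_cont_up)
      show "(\<Union>m\<le>n. F m) \<in> sets lebesgue" for n by (rule UN)
      show "incseq (\<lambda>n. \<Union>m\<le>n. F m)" by (force simp: incseq_def)
    qed (simp add: U h)
    moreover have "(LINT x:(\<Union>m\<le>n. F m)|lebesgue. h x) = integral (\<Union>m\<le>n. F m) h" for n
      by (rule set_lebesgue_integral_eq_integral(2)[OF sub[OF UN_mono UN]]) auto
    ultimately show ?thesis
      using set_lebesgue_integral_eq_integral(2)[OF h] by (simp add: U)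
  qed
  ultimately show ?thesis
    by (intro LIMSEQ_le_const) auto
qed

text \<open>
  The Vitali argument behind Lebesgue differentiation. The intervals with nonnegative average cover
  \<open>E\<close> finely, so disjoint ones among them cover almost all of \<open>E\<close> while staying in an open \<open>T \<supseteq> E\<close> that
  is hardly larger. Over their union the integral of \<open>h\<close> is nonnegative, but \<open>E\<close> contributes at most
  \<open>- \<delta> * |E|\<close> and the rest at most \<open>C * |T - E|\<close>.
\<close>

lemma negligible_if_negative_with_nonneg_averages:
  fixes h :: "real \<Rightarrow> real"
  assumes h: "h \<in> borel_measurable lebesgue" "\<And>x. \<bar>h x\<bar> \<le> C"
    and E: "E \<in> lmeasurable" and "\<delta> > 0" and neg: "\<And>x. x \<in> E \<Longrightarrow> h x \<le> - \<delta>"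
    and avg: "\<And>x d. x \<in> E \<Longrightarrow> d > 0 \<Longrightarrow> \<exists>c r. 0 < r \<and> r < d \<and> x \<in> cball c r \<and> 0 \<le> integral (cball c r) h"
  shows "negligible E"
proof -
  have "C \<ge> 0"
    using h(2)[of 0] by linarith
  have bound: "\<delta> * measure lebesgue E \<le> C * \<epsilon>" if "\<epsilon> > 0" for \<epsilon>
  proof -
    obtain T where T: "open T" "E \<subseteq> T" "T - E \<in> lmeasurable" "emeasure lebesgue (T - E) < ennreal \<epsilon>"
      using sets_lebesgue_outer_open[of E \<epsilon>] E \<open>\<epsilon> > 0\<close> by blast
    have mTE: "measure lebesgue (T - E) < \<epsilon>"
      using T(3,4) \<open>\<epsilon> > 0\<close> by (simp add: emeasure_eq_measure2 ennreal_less_iff)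
    have Tm: "T \<in> lmeasurable"
    proof -
      have "T = E \<union> (T - E)" using T(2) by auto
      with fmeasurable.Un[OF E T(3)] show ?thesis by simp
    qed
    define K where "K = {(c, r). 0 < r \<and> cball c r \<subseteq> T \<and> 0 \<le> integral (cball c r) h}"
    have cov: "\<exists>i. i \<in> K \<and> x \<in> cball (fst i) (snd i) \<and> snd i < d" if xd: "x \<in> E" "0 < d" for x d
    proof -
      obtain e where e: "e > 0" "ball x e \<subseteq> T"
        using openE[OF T(1), of x] T(2) xd(1) by blast
      obtain c r where cr: "0 < r" "r < min d (e/2)" "x \<in> cball c r" "0 \<le> integral (cball c r) h"
        using avg[OF xd(1), of "min d (e/2)"] xd e by auto
      have "cball c r \<subseteq> ball x e"
      proof
        fix y assume "y \<in> cball c r"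
        then show "y \<in> ball x e"
          using cr dist_triangle[of x y c] by (auto simp: dist_commute)
      qed
      then show ?thesis
        using cr e unfolding K_def by (intro exI[of _ "(c, r)"]) auto
    qed
    obtain I where I: "countable I" "I \<subseteq> K"
       "pairwise (\<lambda>i j. disjnt (cball (fst i) (snd i)) (cball (fst j) (snd j))) I"
       "negligible (E - (\<Union>i\<in>I. cball (fst i) (snd i)))"
    proof (rule Vitali_covering_theorem_cballs[of K snd E fst])
      show "0 < snd i" if "i \<in> K" for i
        using that by (auto simp: K_def)
    qed (rule cov)
    define V where "V = (\<Union>i\<in>I. cball (fst i) (snd i))"
    define F where "F n = (if n \<in> to_nat_on I ` I then
        cball (fst (from_nat_into I n)) (snd (from_nat_into I n)) else {})" for n
    have FI: "F (to_nat_on I i) = cball (fst i) (snd i)" if "i \<in> I" for i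
      using that I(1) by (simp add: F_def)
    have VF: "V = (\<Union>n. F n)"
    proof
      show "V \<subseteq> (\<Union>n. F n)" unfolding V_def using FI by blast
      show "(\<Union>n. F n) \<subseteq> V"
      proof
        fix y assume "y \<in> (\<Union>n. F n)"
        then obtain n where n: "y \<in> F n" by blast
        then have "n \<in> to_nat_on I ` I" by (metis F_def empty_iff)
        then obtain i where "i \<in> I" "n = to_nat_on I i" by blast
        then show "y \<in> V" using n FI V_def by blast
      qed
    qed
    have VT: "V \<subseteq> T" 
      using I(2) unfolding V_def K_def by fastforce
    have Vm: "V \<in> lmeasurable"
    proof (rule fmeasurableI2[OF Tm VT])
      have "F n \<in> sets lebesgue" for n by (simp add: F_def)
      then show "V \<in> sets lebesgue" unfolding VF by blast
    qed
    note ai = bounded_measurable_absolutely_integrable[OF h]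
    have iS: "h integrable_on S" if "S \<in> lmeasurable" for S
      using set_lebesgue_integral_eq_integral(1)[OF ai[OF that]] .
    have const_int: "integral S (\<lambda>x. c) = c * measure lebesgue S" if "S \<in> lmeasurable" for S :: "real set" and c :: real
      using integral_mult_right[of S c "\<lambda>x. 1"] lmeasure_integral[OF that] by simp
    have "0 \<le> integral (\<Union>n. F n) h"
    proof (rule integral_nonneg_disjoint_UN)
      show "h absolutely_integrable_on (\<Union>n. F n)"
        using ai[OF Vm] VF by simp
      show "F n \<in> lmeasurable" for n by (simp add: F_def)
      show "F m \<inter> F n = {}" if "m \<noteq> n" for m n
      proof (cases "m \<in> to_nat_on I ` I \<and> n \<in> to_nat_on I ` I")
        case True
        then obtain i j where ij: "i \<in> I" "j \<in> I" "m = to_nat_on I i" "n = to_nat_on I j" by auto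
        then have "i \<noteq> j" using that by metis
        with pairwiseD[OF I(3) ij(1,2)] show ?thesis
          using FI[OF ij(1)] FI[OF ij(2)] ij(3,4) by (simp add: disjnt_def)
      qed (auto simp: F_def)
      show "0 \<le> integral (F n) h" for n
      proof (cases "n \<in> to_nat_on I ` I")
        case True
        then obtain i where "i \<in> I" "n = to_nat_on I i" by auto
        then show ?thesis using I(2) by (auto simp: FI K_def)
      qed (simp add: F_def)
    qed
    then have "0 \<le> integral V h" using VF by simp
    moreover have "integral V h = integral (V \<inter> E) h + integral (V - E) h"
    proof -
      have "V \<inter> E \<inter> (V - E) = {}" "(V \<inter> E) \<union> (V - E) = V" by blast+
      then show ?thesis
        using integral_Un[of h "V \<inter> E" "V - E"] Vm E
        by (simp add: iS fmeasurable.Int fmeasurable.Diff)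
    qed
    moreover have "integral (V \<inter> E) h \<le> - \<delta> * measure lebesgue E"
    proof -
      have "(V \<inter> E) \<union> (E - V) = E" by auto
      moreover have "E - V \<in> null_sets lebesgue"
        using I(4) by (simp add: V_def negligible_iff_null_sets)
      moreover have "V \<inter> E \<in> sets lebesgue"
        using Vm E by (intro fmeasurableD fmeasurable.Int)
      ultimately have "measure lebesgue (V \<inter> E) = measure lebesgue E"
        using measure_Un_null_set[of "V \<inter> E" lebesgue "E - V"] by simp
      moreover have "integral (V \<inter> E) h \<le> integral (V \<inter> E) (\<lambda>x. - \<delta>)"
        using neg by (intro integral_le iS integrable_on_const fmeasurable.Int Vm E) simp
      ultimately show ?thesis
        using const_int[of "V \<inter> E" "- \<delta>"] Vm E by (simp add: fmeasurable.Int)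
    qed
    moreover have "integral (V - E) h \<le> C * measure lebesgue (V - E)"
    proof -
      have "integral (V - E) h \<le> integral (V - E) (\<lambda>x. C)"
        by (intro integral_le iS integrable_on_const fmeasurable.Diff Vm E abs_le_D1[OF h(2)])
      then show ?thesis
        using const_int[of "V - E" C] Vm E by (simp add: fmeasurable.Diff)
    qed
    moreover have "C * measure lebesgue (V - E) \<le> C * \<epsilon>"
    proof (rule mult_left_mono[OF _ \<open>C \<ge> 0\<close>])
      have "measure lebesgue (V - E) \<le> measure lebesgue (T - E)"
        using VT Vm E T(3) by (intro measure_mono_fmeasurable) (auto intro: fmeasurableD)
      then show "measure lebesgue (V - E) \<le> \<epsilon>" using mTE by simp
    qed
    ultimately show ?thesis by simp
  qed
  have "\<delta> * measure lebesgue E \<le> 0"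
  proof (rule field_le_epsilon)
    fix e :: real assume "e > 0"
    have "\<delta> * measure lebesgue E \<le> C * (e / (C + 1))"
      using \<open>C \<ge> 0\<close> \<open>e > 0\<close> by (intro bound) auto
    also have "\<dots> \<le> e"
      using \<open>C \<ge> 0\<close> \<open>e > 0\<close> by (simp add: field_simps)
    finally show "\<delta> * measure lebesgue E \<le> 0 + e" by simp
  qed
  then have "measure lebesgue E = 0"
    using \<open>\<delta> > 0\<close> by (simp add: mult_le_0_iff measure_le_0_iff)
  then show ?thesis
    using E negligible_iff_measure by blast
qed

text \<open>
  The averages are taken over open balls that merely contain \<open>x\<close>. Therefore, for each bound on the
  radius, the points having a large average form an open set, which makes the exceptional set
  measurable.
\<close>

lemma negligible_small_value_large_averages:
  fixes h :: "real \<Rightarrow> real"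
  assumes h: "h \<in> borel_measurable lebesgue" "\<And>x. \<bar>h x\<bar> \<le> C" and "p < q"
  shows "negligible {x \<in> {-k..k}. h x < p \<and>
    (\<forall>n::nat. \<exists>c r. 0 < r \<and> r < inverse (Suc n) \<and> x \<in> ball c r \<and> q * (2 * r) \<le> integral {c - r..c + r} h)}"
    (is "negligible ?E")
proof (rule negligible_if_negative_with_nonneg_averages)
  define U where "U n = (\<Union>c. \<Union>r\<in>{r. 0 < r \<and> r < inverse (Suc n) \<and> q * (2 * r) \<le> integral {c - r..c + r} h}. ball c r)"
    for n :: nat
  have U_iff: "x \<in> U n \<longleftrightarrow>
      (\<exists>c r. 0 < r \<and> r < inverse (Suc n) \<and> x \<in> ball c r \<and> q * (2 * r) \<le> integral {c - r..c + r} h)" for x n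
    unfolding U_def by blast
  have "?E = ({-k..k} \<inter> {x. h x < p}) \<inter> (\<Inter>n. U n)"
    unfolding set_eq_iff Int_iff INT_iff U_iff by simp
  moreover have "{x. h x < p} \<in> sets lebesgue"
    using borel_measurable_less[OF h(1) borel_measurable_const[of p]] by simp
  moreover have "open (U n)" for n
    unfolding U_def by (intro open_UN) auto
  then have "(\<Inter>n. U n) \<in> sets lebesgue"
    by (intro sets.countable_INT) auto
  ultimately show "?E \<in> lmeasurable"
    by (metis (no_types, lifting) fmeasurable_Int_fmeasurable lmeasurable_cbox cbox_interval)
  show "(\<lambda>x. h x - q) \<in> borel_measurable lebesgue"
    using h(1) by measurable
  show "\<bar>h x - q\<bar> \<le> C + \<bar>q\<bar>" for x
    using h(2)[of x] by linarith
  show "0 < q - p" using \<open>p < q\<close> by simp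
  show "h x - q \<le> - (q - p)" if "x \<in> ?E" for x using that by simp
  fix x d :: real assume x: "x \<in> ?E" and "0 < d"
  obtain n where n: "inverse (Suc n) < d"
    using reals_Archimedean[OF \<open>0 < d\<close>] by auto
  obtain c r where cr: "0 < r" "r < inverse (Suc n)" "x \<in> ball c r" "q * (2 * r) \<le> integral {c - r..c + r} h"
    using x by blast
  have "h integrable_on {c - r..c + r}"
    using bounded_measurable_absolutely_integrable[OF h, of "{c - r..c + r}"]
      set_lebesgue_integral_eq_integral(1) by auto
  then have "integral {c - r..c + r} (\<lambda>x. h x - q) = integral {c - r..c + r} h - q * (2 * r)"
    using \<open>0 < r\<close> by (subst integral_diff) (auto simp: algebra_simps)
  then show "\<exists>c r. 0 < r \<and> r < d \<and> x \<in> cball c r \<and> 0 \<le> integral (cball c r) (\<lambda>x. h x - q)"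
    using cr n by (-) (rule exI[where x = c], rule exI[where x = r], auto simp: cball_eq_atLeastAtMost ball_eq_greaterThanLessThan)
qed

text \<open>
  A countable union over rational thresholds \<open>p < q\<close> collects all points at which the averages exceed
  some \<open>q > h x\<close> at arbitrarily small scales. Intervals with \<open>x\<close> as an endpoint are included, because
  one-sided difference quotients of the primitive are averages over such intervals.
\<close>

lemma averages_bounded_above_ae:
  fixes h :: "real \<Rightarrow> real"
  assumes h: "h \<in> borel_measurable lebesgue" "\<And>x. \<bar>h x\<bar> \<le> C"
  obtains N where "negligible N"
    "\<And>x q. x \<notin> N \<Longrightarrow> h x < q \<Longrightarrow>
       \<exists>d>0. \<forall>a b. a \<le> x \<and> x \<le> b \<and> b - a < d \<longrightarrow> integral {a..b} h \<le> q * (b - a)"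
proof -
  define E where "E p q k = {x \<in> {-k..k}. h x < p \<and>
    (\<forall>n::nat. \<exists>c r. 0 < r \<and> r < inverse (Suc n) \<and> x \<in> ball c r \<and> q * (2 * r) \<le> integral {c - r..c + r} h)}" for p q k
  define N where "N = (\<Union>(p, q, k)\<in>{(p, q, k). p \<in> \<rat> \<and> q \<in> \<rat> \<and> k \<in> \<rat> \<and> p < q}. E p q k)"
  have hi: "h integrable_on {a..b}" for a b
    using bounded_measurable_absolutely_integrable[OF h, of "{a..b}"]
      set_lebesgue_integral_eq_integral(1) by auto
  have hC: "\<bar>integral {a..b} h\<bar> \<le> C * (b - a)" if "a \<le> b" for a b
    using has_integral_bound_real[of C "{}" h "integral {a..b} h" a b] h(2)[of 0] h(2) that
      integrable_integral[OF hi[of a b]] by force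
  have "negligible N"
    unfolding N_def
  proof (rule negligible_countable_Union)
    have "countable (\<rat> \<times> \<rat> \<times> (\<rat> :: real set))"
      by (intro countable_SIGMA countable_rat)
    then have "countable {(p, q, k :: real). p \<in> \<rat> \<and> q \<in> \<rat> \<and> k \<in> \<rat> \<and> p < (q::real)}"
      by (rule countable_subset[rotated]) auto
    then show "countable ((\<lambda>(p, q, k). E p q k) ` {(p, q, k). p \<in> \<rat> \<and> q \<in> \<rat> \<and> k \<in> \<rat> \<and> p < q})"
      by (rule countable_image)
    fix S assume "S \<in> (\<lambda>(p, q, k). E p q k) ` {(p, q, k). p \<in> \<rat> \<and> q \<in> \<rat> \<and> k \<in> \<rat> \<and> p < q}"
    then obtain p q k where "p < q" "S = E p q k" by auto
    then show "negligible S"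
      unfolding E_def using negligible_small_value_large_averages[OF h] by blast
  qed
  moreover have "\<exists>d>0. \<forall>a b. a \<le> x \<and> x \<le> b \<and> b - a < d \<longrightarrow> integral {a..b} h \<le> q * (b - a)"
    if x: "x \<notin> N" and q: "h x < q" for x q
  proof -
    obtain q' where q': "q' \<in> \<rat>" "h x < q'" "q' < q"
      using Rats_dense_in_real[OF q] by blast
    obtain p where p: "p \<in> \<rat>" "h x < p" "p < q'"
      using Rats_dense_in_real[OF q'(2)] by blast
    obtain k where k: "k \<in> \<rat>" "\<bar>x\<bar> < k" "k < \<bar>x\<bar> + 1"
      using Rats_dense_in_real[of "\<bar>x\<bar>" "\<bar>x\<bar> + 1"] by auto
    have "x \<notin> E p q' k"
      using x p q' k unfolding N_def by auto
    then obtain n where n: "\<And>c r. 0 < r \<Longrightarrow> r < inverse (Suc n) \<Longrightarrow> x \<in> ball c r \<Longrightarrow>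
        integral {c - r..c + r} h < q' * (2 * r)"
      using p k unfolding E_def by (auto simp: not_le)
    have open_bd: "integral {a..b} h \<le> q' * (b - a)" if "a < x" "x < b" "b - a < 2 * inverse (Suc n)" for a b
    proof -
      define c where "c = (a + b) / 2"
      define r where "r = (b - a) / 2"
      have eqs: "c - r = a" "c + r = b" "2 * r = b - a"
        by (auto simp: c_def r_def field_simps)
      have "integral {c - r..c + r} h < q' * (2 * r)"
        using that eqs by (intro n) (auto simp: ball_eq_greaterThanLessThan)
      then show ?thesis
        unfolding eqs by simp
    qed
    show ?thesis
    proof (intro exI[of _ "inverse (Suc n)"] conjI allI impI)
      fix a b assume ab: "a \<le> x \<and> x \<le> b \<and> b - a < inverse (real (Suc n))"
      show "integral {a..b} h \<le> q * (b - a)"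
      proof (cases "a = b")
        case False
        then have "a < b" using ab by simp
        \<comment> \<open>The point may be an endpoint, so the interval is enlarged by a length that tends to 0.\<close>
        have "(\<lambda>t. q' * (b - a + 2 * t) + 2 * C * t) \<midarrow>0\<rightarrow> q' * (b - a + 2 * 0) + 2 * C * 0"
          by (intro tendsto_intros)
        moreover have "\<forall>\<^sub>F t in at_right 0. integral {a..b} h \<le> q' * (b - a + 2 * t) + 2 * C * t"
        proof -
          have "integral {a..b} h \<le> q' * (b - a + 2 * t) + 2 * C * t" if t: "t > 0" "t < inverse (Suc n) / 2" for t
          proof -
            have "integral {a - t..b + t} h = integral {a - t..a} h + integral {a..b} h + integral {b..b + t} h"
              using Henstock_Kurzweil_Integration.integral_combine[of "a - t" a "b + t" h] Henstock_Kurzweil_Integration.integral_combine[of a b "b + t" h] hi ab t by auto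
            moreover have "integral {a - t..b + t} h \<le> q' * (b + t - (a - t))"
              using ab t by (intro open_bd) auto
            ultimately show ?thesis
              using hC[of "a - t" a] hC[of b "b + t"] t by (simp add: algebra_simps abs_le_iff)
          qed
          then show ?thesis
            by (intro eventually_at_rightI[of 0 "inverse (Suc n) / 2"]) auto
        qed
        ultimately have "integral {a..b} h \<le> q' * (b - a)"
          by (intro tendsto_lowerbound[of "\<lambda>t. q' * (b - a + 2 * t) + 2 * C * t" _ "at_right 0"])
             (auto simp: filterlim_at_split)
        also have "\<dots> \<le> q * (b - a)" using q' \<open>a < b\<close> by (intro mult_right_mono) auto
        finally show ?thesis .
      qed simp
    qed simp
  qed
  ultimately show ?thesis using that by blast
qed

text \<open>
  Upper bounds for the averages of \<open>h\<close> and of \<open>- h\<close> together say that the difference quotients of the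
  primitive converge to \<open>h x\<close>. The exceptional set does not depend on the base point \<open>a\<close>.
\<close>

theorem lebesgue_differentiation_bounded:
  fixes h :: "real \<Rightarrow> real"
  assumes h: "h \<in> borel_measurable lebesgue" "\<And>x. \<bar>h x\<bar> \<le> C"
  obtains N where "negligible N"
    "\<And>a x. x \<notin> N \<Longrightarrow> a < x \<Longrightarrow> ((\<lambda>y. integral {a..y} h) has_real_derivative h x) (at x)"
proof -
  obtain N1 where N1: "negligible N1" "\<And>x q. x \<notin> N1 \<Longrightarrow> h x < q \<Longrightarrow>
       \<exists>d>0. \<forall>a b. a \<le> x \<and> x \<le> b \<and> b - a < d \<longrightarrow> integral {a..b} h \<le> q * (b - a)"
    using averages_bounded_above_ae[OF h] by blast
  have mh: "(\<lambda>x. - h x) \<in> borel_measurable lebesgue" "\<And>x. \<bar>- h x\<bar> \<le> C"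
    using h by auto
  obtain N2 where N2: "negligible N2" "\<And>x q. x \<notin> N2 \<Longrightarrow> - h x < q \<Longrightarrow>
       \<exists>d>0. \<forall>a b. a \<le> x \<and> x \<le> b \<and> b - a < d \<longrightarrow> integral {a..b} (\<lambda>x. - h x) \<le> q * (b - a)"
    using averages_bounded_above_ae[OF mh] by blast
  have hi: "h integrable_on {a..b}" for a b
    using bounded_measurable_absolutely_integrable[OF h, of "{a..b}"]
      set_lebesgue_integral_eq_integral(1) by auto
  show ?thesis
  proof (rule that[of "N1 \<union> N2"])
    show "negligible (N1 \<union> N2)" using N1 N2 by simp
    fix a x assume x: "x \<notin> N1 \<union> N2" "a < x"
    show "((\<lambda>y. integral {a..y} h) has_real_derivative h x) (at x)"
      unfolding has_field_derivative_def has_derivative_at_alt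
    proof (intro conjI allI impI)
      fix e :: real assume "e > 0"
      obtain d1 where d1: "d1 > 0" "\<And>l u. l \<le> x \<Longrightarrow> x \<le> u \<Longrightarrow> u - l < d1 \<Longrightarrow> integral {l..u} h \<le> (h x + e) * (u - l)"
        using N1(2)[of x "h x + e"] x \<open>e > 0\<close> by auto
      obtain d2 where d2: "d2 > 0" "\<And>l u. l \<le> x \<Longrightarrow> x \<le> u \<Longrightarrow> u - l < d2 \<Longrightarrow> - integral {l..u} h \<le> (- h x + e) * (u - l)"
        using N2(2)[of x "- h x + e"] x \<open>e > 0\<close> by auto
      have est: "\<bar>integral {l..u} h - h x * (u - l)\<bar> \<le> e * (u - l)" if "l \<le> x" "x \<le> u" "u - l < min d1 d2" for l u
        using d1(2)[of l u] d2(2)[of l u] that by (simp add: abs_le_iff algebra_simps)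
      have "norm (integral {a..y} h - integral {a..x} h - h x * (y - x)) \<le> e * norm (y - x)"
        if y: "norm (y - x) < min (min d1 d2) (x - a)" for y
      proof (cases "x \<le> y")
        case True
        then have "integral {a..y} h = integral {a..x} h + integral {x..y} h"
          using Henstock_Kurzweil_Integration.integral_combine[of a x y h] hi x by auto
        then show ?thesis using est[of x y] True y by simp
      next
        case False
        then have "integral {a..x} h = integral {a..y} h + integral {y..x} h"
          using Henstock_Kurzweil_Integration.integral_combine[of a y x h] hi y by auto
        then show ?thesis using est[of y x] False y by (simp add: algebra_simps abs_minus_commute abs_le_iff)
      qed
      then show "\<exists>d>0. \<forall>y. norm (y - x) < d \<longrightarrow>
          norm (integral {a..y} h - integral {a..x} h - h x * (y - x)) \<le> e * norm (y - x)"
        using d1 d2 x by (intro exI[of _ "min (min d1 d2) (x - a)"]) auto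
    qed (rule bounded_linear_mult_right)
  qed
qed

section \<open>Lipschitz functions and their derivatives almost everywhere\<close>

lemma AE_lebesgue_on_iff_negligible:
  "(AE x in lebesgue_on {a..b::real}. P x) \<longleftrightarrow> (\<exists>N. negligible N \<and> (\<forall>x\<in>{a..b} - N. P x))"
proof -
  have "(AE x in lebesgue_on {a..b}. P x) \<longleftrightarrow> (AE x in lebesgue. x \<in> {a..b} \<longrightarrow> P x)"
    by (rule AE_restrict_space_iff) simp
  also have "\<dots> \<longleftrightarrow> (\<exists>N. negligible N \<and> {x. \<not> (x \<in> {a..b} \<longrightarrow> P x)} \<subseteq> N)"
    by (rule eventually_ae_filter_negligible)
  also have "\<dots> \<longleftrightarrow> (\<exists>N. negligible N \<and> (\<forall>x\<in>{a..b} - N. P x))"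
    by blast
  finally show ?thesis .
qed

lemma AE_lebesgue_on_negligibleI:
  assumes "negligible N" "\<And>x. x \<in> {a..b::real} \<Longrightarrow> x \<notin> N \<Longrightarrow> P x"
  shows "AE x in lebesgue_on {a..b}. P x"
  using assms unfolding AE_lebesgue_on_iff_negligible by blast

lemma AE_lebesgue_on_interior: "AE x in lebesgue_on {a..b::real}. a < x \<and> x < b"
  by (rule AE_lebesgue_on_negligibleI[of "{a, b}"]) auto

lemma Linf_absolutely_integrable:
  assumes "g \<in> Linf s"
  shows "g absolutely_integrable_on {0..s}"
proof -
  obtain C where C: "AE x in lebesgue_on {0..s}. \<bar>g x\<bar> \<le> C" and m: "g \<in> borel_measurable (lebesgue_on {0..s})"
    using assms unfolding Linf_def by blast
  obtain N where N: "negligible N" "\<And>x. x \<in> {0..s} - N \<Longrightarrow> \<bar>g x\<bar> \<le> C"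
    using C unfolding AE_lebesgue_on_iff_negligible by blast
  have "(\<lambda>x. max (- C) (min C (g x))) absolutely_integrable_on {0..s}"
    by (rule measurable_bounded_by_integrable_imp_absolutely_integrable[where g = "\<lambda>x. \<bar>C\<bar>"]) (use m in auto)
  then show ?thesis
    by (rule absolutely_integrable_spike[OF _ N(1)]) (use N(2) in force)
qed

text \<open>
  The pointwise counterpart of membership in \<open>W\<^sup>1\<^sup>,\<^sup>\<infinity>\<close>. The Lipschitz condition is part of the notion
  because a derivative almost everywhere alone does not determine a function up to a constant. That the
  derivative is two-sided does not matter at the endpoints, which form a null set.
\<close>

definition ae_deriv :: "real \<Rightarrow> (real \<Rightarrow> real) \<Rightarrow> (real \<Rightarrow> real) \<Rightarrow> bool" where
  "ae_deriv s f g \<longleftrightarrow> (\<exists>L. L-lipschitz_on {0..s} f) \<and>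
     (AE x in lebesgue_on {0..s}. (f has_real_derivative g x) (at x))"

lemma ae_derivD: "ae_deriv s f g \<Longrightarrow> AE x in lebesgue_on {0..s}. (f has_real_derivative g x) (at x)"
  unfolding ae_deriv_def by blast

lemma ae_deriv_lipschitz: "ae_deriv s f g \<Longrightarrow> \<exists>L. L-lipschitz_on {0..s} f"
  unfolding ae_deriv_def by blast

lemma ae_deriv_continuous: "ae_deriv s f g \<Longrightarrow> continuous_on {0..s} f"
  using ae_deriv_lipschitz lipschitz_on_continuous_on by blast

lemma ae_deriv_unique:
  assumes "ae_deriv s f g" "ae_deriv s f h"
  shows "AE x in lebesgue_on {0..s}. g x = h x"
  using assms[THEN ae_derivD] by eventually_elim (rule DERIV_unique)

lemma ae_deriv_cong_AE:
  assumes "ae_deriv s f g" "AE x in lebesgue_on {0..s}. g x = h x"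
  shows "ae_deriv s f h"
proof -
  have "AE x in lebesgue_on {0..s}. (f has_real_derivative h x) (at x)"
    using ae_derivD[OF assms(1)] assms(2) by eventually_elim simp
  then show ?thesis using ae_deriv_lipschitz[OF assms(1)] unfolding ae_deriv_def by blast
qed

lemma ae_deriv_diff:
  assumes "ae_deriv s f g" "ae_deriv s u v"
  shows "ae_deriv s (\<lambda>x. f x - u x) (\<lambda>x. g x - v x)"
proof -
  have "AE x in lebesgue_on {0..s}. ((\<lambda>x. f x - u x) has_real_derivative g x - v x) (at x)"
    using assms[THEN ae_derivD] by eventually_elim (rule DERIV_diff)
  then show ?thesis
    using assms[THEN ae_deriv_lipschitz] lipschitz_on_diff unfolding ae_deriv_def by blast
qed

lemma ae_deriv_add:
  assumes "ae_deriv s f g" "ae_deriv s u v"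
  shows "ae_deriv s (\<lambda>x. f x + u x) (\<lambda>x. g x + v x)"
proof -
  have "AE x in lebesgue_on {0..s}. ((\<lambda>x. f x + u x) has_real_derivative g x + v x) (at x)"
    using assms[THEN ae_derivD] by eventually_elim (rule DERIV_add)
  then show ?thesis
    using assms[THEN ae_deriv_lipschitz] lipschitz_on_add unfolding ae_deriv_def by blast
qed

text \<open>
  The difference quotients of \<open>f\<close> are bounded by the Lipschitz constant and converge to \<open>g\<close> almost
  everywhere, so their integrals converge to the integral of \<open>g\<close>. On the other hand, the integral of
  a difference quotient telescopes to the difference of two averages of \<open>f\<close> near the endpoints.
\<close>

lemma lipschitz_ftc:
  fixes f g :: "real \<Rightarrow> real"
  assumes f: "L-lipschitz_on {a..b} f" and "a \<le> b" and N: "negligible N"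
    and der: "\<And>x. a < x \<Longrightarrow> x < b \<Longrightarrow> x \<notin> N \<Longrightarrow> (f has_real_derivative g x) (at x)"
  shows "(g has_integral f b - f a) {a..b}"
proof -
  have "L \<ge> 0" using f by (rule lipschitz_on_nonneg)
  \<comment> \<open>Extending by constants keeps the Lipschitz constant and makes the average to the right of b exact.\<close>
  define F where "F x = f (max a (min b x))" for x
  have FL: "\<bar>F x - F y\<bar> \<le> L * \<bar>x - y\<bar>" for x y
  proof -
    have "\<bar>F x - F y\<bar> \<le> L * \<bar>max a (min b x) - max a (min b y)\<bar>"
      using lipschitz_onD[OF f, of "max a (min b x)" "max a (min b y)"] \<open>a \<le> b\<close>
      by (simp add: F_def dist_real_def)
    also have "\<dots> \<le> L * \<bar>x - y\<bar>"
      using \<open>L \<ge> 0\<close> by (intro mult_left_mono) linarith+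
    finally show ?thesis .
  qed
  then have "L-lipschitz_on UNIV F"
    using \<open>L \<ge> 0\<close> by (intro lipschitz_onI) (auto simp: dist_real_def)
  then have "continuous_on UNIV F"
    by (rule lipschitz_on_continuous_on)
  then have Fc[continuous_intros]: "continuous_on S F" for S
    by (rule continuous_on_subset) simp
  define h where "h n = inverse (real (Suc n))" for n
  have h0: "h n > 0" for n by (simp add: h_def)
  define D where "D n x = (F (x + h n) - F x) / h n" for n x
  define N' where "N' = N \<union> {a, b}"
  have N': "negligible N'" using N by (simp add: N'_def)
  \<comment> \<open>Redefinition on a null set makes the convergence hold at every point.\<close>
  define D' where "D' n x = (if x \<in> N' then 0 else D n x)" for n x
  define g' where "g' x = (if x \<in> N' then 0 else g x)" for x
  have cont_shift: "continuous_on S (\<lambda>x. F (x + c))" for S c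
    by (rule continuous_on_compose2[OF Fc[of UNIV]]) (auto intro!: continuous_intros)
  have Dc: "continuous_on S (D n)" for S n
    unfolding D_def using h0[of n] by (intro continuous_intros cont_shift) auto
  have D'i: "D' n integrable_on {a..b}" for n
    by (rule integrable_spike[OF integrable_continuous_real[OF Dc[of _ n]] N']) (simp add: D'_def)
  have bound: "norm (D' n x) \<le> L" for n x
  proof -
    have "norm (D n x) \<le> L"
      using FL[of "x + h n" x] h0[of n] by (simp add: D_def field_simps)
    then show ?thesis using \<open>L \<ge> 0\<close> by (simp add: D'_def)
  qed
  have conv: "(\<lambda>n. D' n x) \<longlonglongrightarrow> g' x" if "x \<in> {a..b}" for x
  proof (cases "x \<in> N'")
    case False
    then have x: "a < x" "x < b" "x \<notin> N" using that by (auto simp: N'_def)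
    have "(F has_real_derivative g x) (at x)"
    proof (rule has_field_derivative_transform_within_open[OF der[OF x]])
      show "open {a<..<b}" by simp
    qed (use x in \<open>auto simp: F_def\<close>)
    then have "(\<lambda>t. (F (x + t) - F x) / t) \<midarrow>0\<rightarrow> g x"
      by (simp add: DERIV_def)
    moreover have "filterlim h (at 0) sequentially"
      unfolding filterlim_at h_def using LIMSEQ_inverse_real_of_nat by (auto intro!: always_eventually)
    ultimately have "(\<lambda>n. (F (x + h n) - F x) / h n) \<longlonglongrightarrow> g x"
      by (rule filterlim_compose)
    then show ?thesis using False by (simp add: D'_def D_def g'_def)
  qed (simp add: D'_def g'_def)
  have g'i: "g' integrable_on {a..b}"
    by (rule dominated_convergence(1)[where f = D' and h = "\<lambda>x. L", OF D'i _ bound conv])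
      (intro integrable_continuous_real continuous_intros)
  have lim: "(\<lambda>n. integral {a..b} (D' n)) \<longlonglongrightarrow> integral {a..b} g'"
    by (rule dominated_convergence(2)[where f = D' and h = "\<lambda>x. L", OF D'i _ bound conv])
      (intro integrable_continuous_real continuous_intros)
  have est: "\<bar>integral {a..b} (D' n) - (f b - f a)\<bar> \<le> L * h n" for n
  proof -
    have Fi: "F integrable_on {c..d}" for c d by (intro integrable_continuous_real Fc)
    have bd: "\<bar>integral {c..c + h n} F - h n * F c\<bar> \<le> h n * (L * h n)" for c
    proof -
      have "((\<lambda>x. F x - F c) has_integral (integral {c..c + h n} F - h n * F c)) {c..c + h n}"
        using has_integral_diff[OF integrable_integral[OF Fi] has_integral_const_real[of "F c" c "c + h n"]] h0[of n]
        by simp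
      then have "norm (integral {c..c + h n} F - h n * F c) \<le> (L * h n) * measure lborel {c..c + h n}"
      proof (rule has_integral_bound_real[rotated 2])
        fix x assume "x \<in> {c..c + h n} - {}"
        then have "L * \<bar>x - c\<bar> \<le> L * h n" using \<open>L \<ge> 0\<close> by (intro mult_left_mono) auto
        then show "norm (F x - F c) \<le> L * h n" using FL[of x c] by simp
      qed (use \<open>L \<ge> 0\<close> h0[of n] in auto)
      then show ?thesis using h0[of n] by (simp add: mult.commute)
    qed
    have "integral {b..b + h n} F = integral {b..b + h n} (\<lambda>x. F b)"
      using \<open>a \<le> b\<close> by (intro integral_cong) (simp add: F_def)
    then have top: "integral {b..b + h n} F = h n * F b"
      using h0[of n] by simp
    have "integral {a..b} (D' n) = integral {a..b} (D n)"
      by (rule integral_spike[OF N']) (simp add: D'_def)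
    also have "\<dots> = (integral {a..b} (\<lambda>x. F (x + h n)) - integral {a..b} F) / h n"
      unfolding D_def using integrable_continuous_real[OF cont_shift] Fi
      by (simp add: integral_diff)
    also have "integral {a..b} (\<lambda>x. F (x + h n)) = integral {a + h n..b + h n} F"
      using integral_shift[of a "h n" b F] Fc by (simp add: o_def)
    also have "\<dots> = integral {a..b} F + integral {b..b + h n} F - integral {a..a + h n} F"
      using Henstock_Kurzweil_Integration.integral_combine[of a b "b + h n" F]
        Henstock_Kurzweil_Integration.integral_combine[of a "a + h n" "b + h n" F] Fi h0[of n] \<open>a \<le> b\<close> by simp
    finally have "integral {a..b} (D' n) - (F b - F a) = - (integral {a..a + h n} F - h n * F a) / h n"
      using h0[of n] by (simp add: top field_simps)
    also have "\<bar>\<dots>\<bar> = \<bar>integral {a..a + h n} F - h n * F a\<bar> / h n"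
      using h0[of n] by simp
    also have "\<dots> \<le> L * h n"
      using bd[of a] h0[of n] by (simp add: divide_le_eq mult.commute)
    finally show ?thesis using \<open>a \<le> b\<close> by (simp add: F_def)
  qed
  have "(\<lambda>n. integral {a..b} (D' n)) \<longlonglongrightarrow> f b - f a"
  proof (rule LIM_zero_cancel, rule Lim_null_comparison)
    show "\<forall>\<^sub>F n in sequentially. norm (integral {a..b} (D' n) - (f b - f a)) \<le> L * h n"
      using est by simp
    show "(\<lambda>n. L * h n) \<longlonglongrightarrow> 0"
      unfolding h_def using tendsto_mult_left[OF LIMSEQ_inverse_real_of_nat, of L] by simp
  qed
  with lim have "integral {a..b} g' = f b - f a"
    by (rule LIMSEQ_unique)
  with g'i have "(g' has_integral f b - f a) {a..b}"
    by (metis integrable_integral)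
  then show ?thesis
    by (rule has_integral_spike[OF N', rotated]) (simp add: g'_def)
qed

lemma ae_deriv_ftc:
  assumes "ae_deriv s f g" "0 \<le> a" "a \<le> b" "b \<le> s"
  shows "(g has_integral f b - f a) {a..b}"
proof -
  obtain L where L: "L-lipschitz_on {0..s} f"
    using assms(1) unfolding ae_deriv_def by blast
  obtain N where N: "negligible N" "\<And>x. x \<in> {0..s} - N \<Longrightarrow> (f has_real_derivative g x) (at x)"
    using assms(1) unfolding ae_deriv_def AE_lebesgue_on_iff_negligible by blast
  show ?thesis
    by (rule lipschitz_ftc[OF lipschitz_on_subset[OF L] _ N(1)]) (use assms N in auto)
qed

lemma ae_deriv_Linf:
  assumes "ae_deriv s f g" "0 \<le> s"
  shows "g \<in> Linf s"
proof -
  obtain L where L: "L-lipschitz_on {0..s} f"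
    using assms(1) unfolding ae_deriv_def by blast
  have "g integrable_on {0..s}"
    using ae_deriv_ftc[OF assms(1), of 0 s] assms(2) by (auto simp: integrable_on_def)
  then have "g \<in> borel_measurable (lebesgue_on {0..s})"
    by (rule integrable_imp_measurable)
  moreover have "AE x in lebesgue_on {0..s}. \<bar>g x\<bar> \<le> L"
    using ae_derivD[OF assms(1)] AE_lebesgue_on_interior[of 0 s]
  proof eventually_elim
    case (elim x)
    have "((\<lambda>y. \<bar>(f y - f x) / (y - x)\<bar>) \<longlongrightarrow> \<bar>g x\<bar>) (at x)"
      using elim(1) unfolding has_field_derivative_iff by (intro tendsto_intros)
    moreover have "\<forall>\<^sub>F y in at x. \<bar>(f y - f x) / (y - x)\<bar> \<le> L"
    proof -
      have "\<forall>\<^sub>F y in at x. y \<in> {0<..<s}"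
        using elim(2) by (intro eventually_at_in_open') auto
      moreover have "\<forall>\<^sub>F y in at x. y \<noteq> x"
        by (simp add: eventually_at_filter)
      ultimately show ?thesis
      proof eventually_elim
        case (elim y)
        then show ?case
          using lipschitz_onD[OF L, of y x] \<open>0 < x \<and> x < s\<close> by (simp add: dist_real_def divide_le_eq)
      qed
    qed
    ultimately show ?case
      by (rule tendsto_upperbound) simp
  qed
  ultimately show ?thesis unfolding Linf_def by blast
qed

lemma Linf_antiderivative:
  assumes "g \<in> Linf s" "0 \<le> s"
  shows "ae_deriv s (\<lambda>x. integral {0..x} g) g"
proof -
  obtain C where C: "AE x in lebesgue_on {0..s}. \<bar>g x\<bar> \<le> C" and m: "g \<in> borel_measurable (lebesgue_on {0..s})"
    using assms unfolding Linf_def by blast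
  obtain N where N: "negligible N" "\<And>x. x \<in> {0..s} - N \<Longrightarrow> \<bar>g x\<bar> \<le> C"
    using C unfolding AE_lebesgue_on_iff_negligible by blast
  \<comment> \<open>Truncation at the essential bound changes g only on a null set, but makes it bounded everywhere.\<close>
  define h where "h x = (if x \<in> {0..s} then max (- \<bar>C\<bar>) (min \<bar>C\<bar> (g x)) else 0)" for x
  have "h \<in> borel_measurable (lebesgue_on UNIV)"
    unfolding h_def by (subst borel_measurable_if_lebesgue_on) (use m in auto)
  then have hm: "h \<in> borel_measurable lebesgue" by (simp add: lebesgue_on_UNIV_eq)
  have hb: "\<bar>h x\<bar> \<le> \<bar>C\<bar>" for x by (auto simp: h_def)
  have hg: "h x = g x" if "x \<in> {0..s} - N" for x
    using N(2)[OF that] that by (auto simp: h_def)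
  have hi: "h integrable_on {a..b}" for a b
    using bounded_measurable_absolutely_integrable[OF hm hb, of "{a..b}"]
      set_lebesgue_integral_eq_integral(1) by auto
  have int_eq: "integral {0..x} g = integral {0..x} h" if "x \<in> {0..s}" for x
    by (rule integral_spike[OF N(1)]) (use hg that in auto)
  obtain M where M: "negligible M"
    "\<And>a x. x \<notin> M \<Longrightarrow> a < x \<Longrightarrow> ((\<lambda>y. integral {a..y} h) has_real_derivative h x) (at x)"
    using lebesgue_differentiation_bounded[OF hm hb] by blast
  have "AE x in lebesgue_on {0..s}. ((\<lambda>x. integral {0..x} g) has_real_derivative g x) (at x)"
  proof (rule AE_lebesgue_on_negligibleI)
    show "negligible (M \<union> N \<union> {0, s})" using M N by simp
    fix x assume x: "x \<in> {0..s}" "x \<notin> M \<union> N \<union> {0, s}"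
    have "((\<lambda>y. integral {0..y} g) has_real_derivative h x) (at x)"
    proof (rule has_field_derivative_transform_within_open[OF M(2)[of x 0]])
      show "open {0<..<s}" by simp
    qed (use x int_eq in auto)
    then show "((\<lambda>y. integral {0..y} g) has_real_derivative g x) (at x)"
      using hg[of x] x by simp
  qed
  moreover have "\<bar>C\<bar>-lipschitz_on {0..s} (\<lambda>x. integral {0..x} g)"
  proof (rule lipschitz_on_leI)
    fix x y assume xy: "x \<in> {0..s}" "y \<in> {0..s}" "x \<le> y"
    have "integral {0..y} h = integral {0..x} h + integral {x..y} h"
      using Henstock_Kurzweil_Integration.integral_combine[of 0 x y h] hi xy by simp
    moreover have "norm (integral {x..y} h) \<le> \<bar>C\<bar> * measure lborel {x..y}"
      using hb by (intro has_integral_bound_real[OF _ _ integrable_integral[OF hi], of _ "{}"]) auto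
    ultimately show "dist (integral {0..x} g) (integral {0..y} g) \<le> \<bar>C\<bar> * dist x y"
      using int_eq xy by (simp add: dist_real_def)
  qed simp
  ultimately show ?thesis unfolding ae_deriv_def by blast
qed

section \<open>Test functions\<close>

text \<open>
  The classical flat function \<open>exp (- 1 / t)\<close> together with the factors \<open>t\<close> to the power \<open>- n\<close> that its
  derivatives produce; the family is closed under differentiation up to linear combinations.
\<close>

definition flat :: "nat \<Rightarrow> real \<Rightarrow> real" where
  "flat n t = (if 0 < t then inverse t ^ n * exp (- inverse t) else 0)"

lemma flat_tendsto_0: "(flat n \<longlongrightarrow> 0) (at 0)"
proof -
  have "((\<lambda>u::real. u ^ n / exp u) \<longlongrightarrow> 0) at_top"
    by (rule tendsto_power_div_exp_0)
  then have "((\<lambda>t. inverse t ^ n / exp (inverse t)) \<longlongrightarrow> (0::real)) (at_right 0)"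
    using filterlim_compose filterlim_inverse_at_top_right by blast
  then have "(flat n \<longlongrightarrow> 0) (at_right 0)"
  proof (rule Lim_transform_eventually)
    show "\<forall>\<^sub>F t in at_right 0. inverse t ^ n / exp (inverse t) = flat n t"
      by (auto simp: flat_def exp_minus eventually_at_filter divide_inverse)
  qed
  moreover have "(flat n \<longlongrightarrow> 0) (at_left 0)"
  proof (rule Lim_transform_eventually)
    show "\<forall>\<^sub>F t in at_left 0. 0 = flat n t"
      by (auto simp: flat_def eventually_at_filter)
  qed simp
  ultimately show ?thesis
    by (simp add: filterlim_at_split)
qed

lemma flat_has_derivative:
  "(flat n has_real_derivative flat (n + 2) t - n * flat (n + 1) t) (at t)"
proof (cases t "0::real" rule: linorder_cases)
  case greater
  have "((\<lambda>t. inverse t ^ n * exp (- inverse t)) has_real_derivative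
      inverse t ^ n * (exp (- inverse t) * (inverse t)\<^sup>2) + n * (inverse t ^ (n - 1) * - (inverse t)\<^sup>2) * exp (- inverse t)) (at t)"
    using greater by (auto intro!: derivative_eq_intros simp: power2_eq_square)
  moreover have "inverse t ^ n * (exp (- inverse t) * (inverse t)\<^sup>2) + n * (inverse t ^ (n - 1) * - (inverse t)\<^sup>2) * exp (- inverse t)
      = flat (n + 2) t - n * flat (n + 1) t"
    using greater by (cases n) (auto simp: flat_def power2_eq_square algebra_simps)
  ultimately have "((\<lambda>t. inverse t ^ n * exp (- inverse t)) has_real_derivative
      flat (n + 2) t - n * flat (n + 1) t) (at t)"
    by simp
  then show ?thesis
  proof (rule has_field_derivative_transform_within_open)
    show "open {0::real<..}" by simp
  qed (use greater in \<open>simp_all add: flat_def\<close>)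
next
  case less
  have "((\<lambda>t. 0) has_real_derivative flat (n + 2) t - n * flat (n + 1) t) (at t)"
    using less by (simp add: flat_def)
  then show ?thesis
  proof (rule has_field_derivative_transform_within_open)
    show "open {..<0::real}" by simp
  qed (use less in \<open>simp_all add: flat_def\<close>)
next
  case equal
  have "((\<lambda>y. (flat n y - flat n 0) / (y - 0)) \<longlongrightarrow> 0) (at 0)"
  proof (rule Lim_transform_eventually[OF flat_tendsto_0[of "Suc n"]])
    show "\<forall>\<^sub>F y in at 0. flat (Suc n) y = (flat n y - flat n 0) / (y - 0)"
      by (auto simp: flat_def eventually_at_filter divide_inverse)
  qed
  then show ?thesis
    unfolding has_field_derivative_iff equal by (simp add: flat_def)
qed

text \<open>
  Smoothness of all orders is obtained from a set of functions that is closed under differentiation;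
  closing the flat functions under sums, products and affine substitutions is enough for this.
\<close>

inductive_set flat_algebra :: "(real \<Rightarrow> real) set" where
  gen: "(\<lambda>x. flat n (c * x + d)) \<in> flat_algebra"
| add: "f \<in> flat_algebra \<Longrightarrow> g \<in> flat_algebra \<Longrightarrow> (\<lambda>x. f x + g x) \<in> flat_algebra"
| mult: "f \<in> flat_algebra \<Longrightarrow> g \<in> flat_algebra \<Longrightarrow> (\<lambda>x. f x * g x) \<in> flat_algebra"
| scale: "f \<in> flat_algebra \<Longrightarrow> (\<lambda>x. c * f x) \<in> flat_algebra"

lemma flat_algebra_deriv:
  assumes "f \<in> flat_algebra"
  shows "\<exists>f'\<in>flat_algebra. \<forall>x. (f has_real_derivative f' x) (at x)"
  using assms
proof induction
  case (gen n c d)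
  have der: "((\<lambda>x. flat n (c * x + d)) has_real_derivative
      c * (flat (n + 2) (c * x + d) + (- real n) * flat (n + 1) (c * x + d))) (at x)" for x
    by (rule DERIV_cong[OF DERIV_chain2[where g = "\<lambda>x. c * x + d" and Db = c, OF flat_has_derivative]])
      (auto intro!: derivative_eq_intros)
  have "(\<lambda>x. c * (flat (n + 2) (c * x + d) + (- real n) * flat (n + 1) (c * x + d))) \<in> flat_algebra"
    by (intro flat_algebra.intros)
  then show ?case
    by (rule bexI[rotated]) (intro allI der)
next
  case (add f g)
  then obtain f' g' where "f' \<in> flat_algebra" "g' \<in> flat_algebra"
    "\<forall>x. (f has_real_derivative f' x) (at x)" "\<forall>x. (g has_real_derivative g' x) (at x)" by blast
  then show ?case
    by (intro bexI[of _ "\<lambda>x. f' x + g' x"]) (auto intro!: flat_algebra.intros DERIV_add)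
next
  case (mult f g)
  then obtain f' g' where *: "f' \<in> flat_algebra" "g' \<in> flat_algebra"
    "\<forall>x. (f has_real_derivative f' x) (at x)" "\<forall>x. (g has_real_derivative g' x) (at x)" by blast
  have "((\<lambda>x. f x * g x) has_real_derivative f' x * g x + g' x * f x) (at x)" for x
    using * by (intro DERIV_mult) auto
  then show ?case
    using * mult by (intro bexI[of _ "\<lambda>x. f' x * g x + g' x * f x"]) (auto intro!: flat_algebra.intros)
next
  case (scale f c)
  then obtain f' where "f' \<in> flat_algebra" "\<forall>x. (f has_real_derivative f' x) (at x)" by blast
  then show ?case
    by (intro bexI[of _ "\<lambda>x. c * f' x"]) (auto intro!: flat_algebra.intros DERIV_cmult)
qed

lemma flat_algebra_smooth:
  assumes "f \<in> flat_algebra"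
  shows "(deriv ^^ n) f differentiable (at x)"
proof -
  have "(deriv ^^ n) f \<in> flat_algebra"
  proof (induction n)
    case (Suc n)
    then obtain f' where "f' \<in> flat_algebra" "\<forall>x. ((deriv ^^ n) f has_real_derivative f' x) (at x)"
      using flat_algebra_deriv by blast
    moreover from this(2) have "deriv ((deriv ^^ n) f) = f'"
      by (intro ext DERIV_imp_deriv) simp
    ultimately show ?case by simp
  qed (use assms in simp)
  then show ?thesis
    using flat_algebra_deriv real_differentiable_def by blast
qed

text \<open>
  A smooth function supported in \<open>[a, b]\<close> that increases up to the midpoint, decreases after it, and
  tends to the indicator of the open interval as \<open>n\<close> grows; its derivative is \<open>bump'\<close>.
\<close>

definition bump :: "real \<Rightarrow> real \<Rightarrow> nat \<Rightarrow> real \<Rightarrow> real" where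
  "bump a b n x = flat 0 (real (Suc n) * (x - a)) * flat 0 (real (Suc n) * (b - x))"

definition bump' :: "real \<Rightarrow> real \<Rightarrow> nat \<Rightarrow> real \<Rightarrow> real" where
  "bump' a b n x = real (Suc n) * (flat 2 (real (Suc n) * (x - a)) * flat 0 (real (Suc n) * (b - x))
                           - flat 0 (real (Suc n) * (x - a)) * flat 2 (real (Suc n) * (b - x)))"

lemma bump_has_derivative: "(bump a b n has_real_derivative bump' a b n x) (at x)"
proof -
  have 1: "((\<lambda>x. flat 0 (real (Suc n) * (x - a))) has_real_derivative flat 2 (real (Suc n) * (x - a)) * real (Suc n)) (at x)"
    by (rule DERIV_chain2[OF DERIV_cong[OF flat_has_derivative[of 0]]]) (auto intro!: derivative_eq_intros simp: numeral_2_eq_2)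
  have 2: "((\<lambda>x. flat 0 (real (Suc n) * (b - x))) has_real_derivative flat 2 (real (Suc n) * (b - x)) * - real (Suc n)) (at x)"
    by (rule DERIV_chain2[OF DERIV_cong[OF flat_has_derivative[of 0]]]) (auto intro!: derivative_eq_intros simp: numeral_2_eq_2)
  show ?thesis
    unfolding bump_def bump'_def by (rule DERIV_cong[OF DERIV_mult[OF 1 2]]) (simp add: algebra_simps)
qed

lemma bump_in_test_funs:
  assumes "0 < a" "b < s"
  shows "bump a b n \<in> test_funs s"
proof -
  have "bump a b n = (\<lambda>x. flat 0 (real (Suc n) * x + - (real (Suc n) * a)) * flat 0 ((- real (Suc n)) * x + real (Suc n) * b))"
    by (simp add: bump_def fun_eq_iff algebra_simps)
  also have "\<dots> \<in> flat_algebra"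
    by (intro flat_algebra.intros)
  finally have "(deriv ^^ k) (bump a b n) differentiable (at x)" for k x
    by (rule flat_algebra_smooth)
  moreover have "bump a b n x = 0" if "x \<notin> {a..b}" for x
    using that by (auto simp: bump_def flat_def zero_less_mult_iff)
  ultimately show ?thesis
    using assms unfolding test_funs_def by blast
qed

lemma bump_bounds: "0 \<le> bump a b n x" "bump a b n x \<le> 1"
proof -
  have "0 \<le> flat 0 t \<and> flat 0 t \<le> 1" for t by (simp add: flat_def)
  then show "0 \<le> bump a b n x" "bump a b n x \<le> 1"
    unfolding bump_def by (simp_all add: mult_le_one)
qed

lemma bump_tendsto:
  assumes "a < x" "x < b"
  shows "(\<lambda>n. bump a b n x) \<longlonglongrightarrow> 1"
proof -
  have *: "(\<lambda>n. flat 0 (real (Suc n) * t)) \<longlonglongrightarrow> 1" if "t > 0" for t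
  proof -
    have "(\<lambda>n. exp (- (inverse (real (Suc n)) * inverse t))) \<longlonglongrightarrow> exp (- (0 * inverse t))"
      by (intro tendsto_intros LIMSEQ_inverse_real_of_nat)
    then show ?thesis using that by (simp add: flat_def)
  qed
  show ?thesis
    unfolding bump_def using tendsto_mult[OF *[of "x - a"] *[of "b - x"]] assms by simp
qed

text \<open>
  The logarithmic derivative is \<open>1 / (n (x - a)\<^sup>2) - 1 / (n (b - x)\<^sup>2)\<close> with \<open>n\<close> standing for \<open>Suc n\<close>,
  which is nonnegative on the left half.
\<close>

lemma bump'_nonneg:
  assumes "x - a \<le> b - x"
  shows "0 \<le> bump' a b n x"
proof (cases "0 < x - a")
  case True
  then have "0 < b - x" using assms by simp
  have "inverse (real (Suc n) * (b - x)) ^ 2 \<le> inverse (real (Suc n) * (x - a)) ^ 2"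
    using True assms by (intro power_mono le_imp_inverse_le mult_left_mono) auto
  then have "0 \<le> real (Suc n) * (exp (- inverse (real (Suc n) * (x - a))) * exp (- inverse (real (Suc n) * (b - x))) *
      (inverse (real (Suc n) * (x - a)) ^ 2 - inverse (real (Suc n) * (b - x)) ^ 2))"
    by (intro mult_nonneg_nonneg) auto
  then show ?thesis
    using True \<open>0 < b - x\<close> unfolding bump'_def flat_def by (simp add: zero_less_mult_iff algebra_simps)
qed (simp add: bump'_def flat_def zero_less_mult_iff)

lemma bump'_reflect: "bump' a b n (a + b - x) = - bump' a b n x"
  by (simp add: bump'_def algebra_simps)

lemma bump'_nonpos:
  assumes "b - x \<le> x - a"
  shows "bump' a b n x \<le> 0"
  using bump'_nonneg[of "a + b - x" a b n] assms by (simp add: bump'_reflect)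

lemma bump'_eq_0: "x \<le> a \<or> b \<le> x \<Longrightarrow> bump' a b n x = 0"
  by (auto simp: bump'_def flat_def zero_less_mult_iff)

section \<open>Weak derivatives and derivatives almost everywhere\<close>

lemma continuous_imp_Linf:
  assumes "continuous_on {0..s} f"
  shows "f \<in> Linf s"
proof -
  have "bounded (f ` {0..s})"
    using assms by (intro compact_imp_bounded compact_continuous_image) auto
  then obtain C where "\<And>x. x \<in> {0..s} \<Longrightarrow> \<bar>f x\<bar> \<le> C"
    unfolding bounded_iff by (metis image_eqI real_norm_def)
  then have "AE x in lebesgue_on {0..s}. \<bar>f x\<bar> \<le> C"
    by (intro AE_lebesgue_on_negligibleI[of "{}"]) auto
  moreover have "f \<in> borel_measurable (lebesgue_on {0..s})"
    using assms by (intro continuous_imp_measurable_on_sets_lebesgue) auto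
  ultimately show ?thesis unfolding Linf_def by blast
qed

lemma Linf_mult:
  assumes "f \<in> Linf s" "g \<in> Linf s"
  shows "(\<lambda>x. f x * g x) \<in> Linf s"
proof -
  obtain C D where CD: "AE x in lebesgue_on {0..s}. \<bar>f x\<bar> \<le> C" "AE x in lebesgue_on {0..s}. \<bar>g x\<bar> \<le> D"
    using assms unfolding Linf_def by blast
  have "AE x in lebesgue_on {0..s}. \<bar>f x * g x\<bar> \<le> \<bar>C\<bar> * \<bar>D\<bar>"
    using CD
  proof eventually_elim
    case (elim x)
    then show ?case unfolding abs_mult by (intro mult_mono) auto
  qed
  moreover have "(\<lambda>x. f x * g x) \<in> borel_measurable (lebesgue_on {0..s})"
    using assms unfolding Linf_def by (intro borel_measurable_times) auto
  ultimately show ?thesis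
    unfolding Linf_def by blast
qed

lemma Linf_lebesgue_integral:
  assumes "h \<in> Linf s"
  shows "(LINT x|lebesgue_on {0..s}. h x) = integral {0..s} h"
  using Linf_absolutely_integrable[OF assms]
  by (intro lebesgue_integral_eq_integral absolutely_integrable_imp_integrable) auto

lemma Linf_integrable: "h \<in> Linf s \<Longrightarrow> h integrable_on {0..s}"
  using Linf_absolutely_integrable set_lebesgue_integral_eq_integral(1) by blast

lemma ae_deriv_mult:
  assumes "ae_deriv s f g" "ae_deriv s u v"
  shows "ae_deriv s (\<lambda>x. f x * u x) (\<lambda>x. g x * u x + f x * v x)"
proof -
  obtain K L where KL: "K-lipschitz_on {0..s} f" "L-lipschitz_on {0..s} u"
    using assms[THEN ae_deriv_lipschitz] by blast
  then have KL0: "0 \<le> K" "0 \<le> L" using lipschitz_on_nonneg by blast+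
  have "bounded (f ` {0..s})" "bounded (u ` {0..s})"
    using assms[THEN ae_deriv_continuous] by (auto intro!: compact_imp_bounded compact_continuous_image)
  then obtain C D where CD: "\<And>x. x \<in> {0..s} \<Longrightarrow> \<bar>f x\<bar> \<le> C" "\<And>x. x \<in> {0..s} \<Longrightarrow> \<bar>u x\<bar> \<le> D"
    unfolding bounded_iff by (metis image_eqI real_norm_def)
  have "(\<bar>C\<bar> * L + K * \<bar>D\<bar>)-lipschitz_on {0..s} (\<lambda>x. f x * u x)"
  proof (rule lipschitz_onI)
    fix x y assume xy: "x \<in> {0..s}" "y \<in> {0..s}"
    have "\<bar>f x * u x - f y * u y\<bar> = \<bar>f x * (u x - u y) + (f x - f y) * u y\<bar>"
      by (simp add: algebra_simps)
    also have "\<dots> \<le> \<bar>f x\<bar> * \<bar>u x - u y\<bar> + \<bar>f x - f y\<bar> * \<bar>u y\<bar>"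
      by (metis abs_mult abs_triangle_ineq)
    also have "\<dots> \<le> \<bar>C\<bar> * (L * \<bar>x - y\<bar>) + (K * \<bar>x - y\<bar>) * \<bar>D\<bar>"
      using CD(1)[OF xy(1)] CD(2)[OF xy(2)] lipschitz_onD[OF KL(1) xy] lipschitz_onD[OF KL(2) xy] KL0
      by (intro add_mono mult_mono) (auto simp: dist_real_def)
    finally show "dist (f x * u x) (f y * u y) \<le> (\<bar>C\<bar> * L + K * \<bar>D\<bar>) * dist x y"
      by (simp add: dist_real_def algebra_simps)
  qed (use KL0 in auto)
  moreover have "AE x in lebesgue_on {0..s}. ((\<lambda>x. f x * u x) has_real_derivative g x * u x + f x * v x) (at x)"
    using assms[THEN ae_derivD]
  proof eventually_elim
    case (elim x)
    show ?case by (rule DERIV_cong[OF DERIV_mult[OF elim]]) simp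
  qed
  ultimately show ?thesis unfolding ae_deriv_def by blast
qed

lemma C1_ae_deriv:
  assumes "\<And>x. (\<phi> has_real_derivative \<phi>' x) (at x)" "continuous_on UNIV \<phi>'"
  shows "ae_deriv s \<phi> \<phi>'"
proof -
  have "bounded (\<phi>' ` {0..s})"
    using assms(2) continuous_on_subset by (intro compact_imp_bounded compact_continuous_image) auto
  then obtain C where C: "\<And>x. x \<in> {0..s} \<Longrightarrow> \<bar>\<phi>' x\<bar> \<le> C"
    unfolding bounded_iff by (metis image_eqI real_norm_def)
  have "\<bar>C\<bar>-lipschitz_on {0..s} \<phi>"
  proof (rule bounded_derivative_imp_lipschitz)
    show "(\<phi> has_derivative (*) (\<phi>' x)) (at x within {0..s})" for x
      using assms(1)[of x] has_field_derivative_at_within has_field_derivative_def by blast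
    show "onorm ((*) (\<phi>' x)) \<le> \<bar>C\<bar>" if "x \<in> {0..s}" for x
      using C[OF that] by (intro onorm_le) (simp add: abs_mult mult_right_mono)
  qed auto
  then show ?thesis using assms(1) unfolding ae_deriv_def by auto
qed

lemma test_funD:
  assumes "\<phi> \<in> test_funs s"
  shows "ae_deriv s \<phi> (deriv \<phi>)" "continuous_on UNIV (deriv \<phi>)" "\<phi> 0 = 0" "\<phi> s = 0"
proof -
  have d: "(deriv ^^ n) \<phi> differentiable (at x)" for n x
    using assms unfolding test_funs_def by blast
  have 1: "(\<phi> has_real_derivative deriv \<phi> x) (at x)" for x
    using d[of 0 x] by (simp add: DERIV_deriv_iff_real_differentiable)
  show 2: "continuous_on UNIV (deriv \<phi>)"
    using d[of 1] by (intro differentiable_imp_continuous_on) (auto simp: differentiable_on_def)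
  show "ae_deriv s \<phi> (deriv \<phi>)"
    by (rule C1_ae_deriv[OF 1 2])
  obtain a b where "0 < a" "b < s" "\<And>x. x \<notin> {a..b} \<Longrightarrow> \<phi> x = 0"
    using assms unfolding test_funs_def by blast
  then show "\<phi> 0 = 0" "\<phi> s = 0" by auto
qed

text \<open>
  Integration by parts: the product with a test function is Lipschitz and vanishes at both ends, so
  the integral of its derivative is 0.
\<close>

lemma ae_deriv_imp_weak_deriv:
  assumes f: "ae_deriv s f g" and "0 \<le> s"
  shows "has_weak_deriv s f g"
  unfolding has_weak_deriv_def
proof
  fix \<phi> assume "\<phi> \<in> test_funs s"
  note \<phi> = test_funD[OF this]
  have "ae_deriv s (\<lambda>x. f x * \<phi> x) (\<lambda>x. g x * \<phi> x + f x * deriv \<phi> x)"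
    by (rule ae_deriv_mult[OF f \<phi>(1)])
  from ae_deriv_ftc[OF this, of 0 s]
  have "integral {0..s} (\<lambda>x. g x * \<phi> x + f x * deriv \<phi> x) = 0"
    using \<open>0 \<le> s\<close> \<phi>(3,4) by (auto dest: integral_unique)
  moreover have L: "(\<lambda>x. g x * \<phi> x) \<in> Linf s" "(\<lambda>x. f x * deriv \<phi> x) \<in> Linf s"
    using ae_deriv_Linf[OF f] ae_deriv_continuous[OF f] ae_deriv_continuous[OF \<phi>(1)]
      continuous_on_subset[OF \<phi>(2)] \<open>0 \<le> s\<close>
    by (auto intro: Linf_mult continuous_imp_Linf)
  ultimately show "(LINT x|lebesgue_on {0..s}. f x * deriv \<phi> x) = - (LINT x|lebesgue_on {0..s}. g x * \<phi> x)"
    using integral_add[OF Linf_integrable[OF L(1)] Linf_integrable[OF L(2)]]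
    by (simp add: Linf_lebesgue_integral)
qed

text \<open>
  Testing \<open>u\<close> against \<open>bump'\<close> compares \<open>u a\<close> with \<open>u b\<close>. On the left half \<open>bump'\<close> is nonnegative and
  \<open>\<bar>u x - u a\<bar> \<le> L * (x - a)\<close>, so replacing \<open>u\<close> by \<open>u a\<close> costs at most \<open>L\<close> times the first moment of
  \<open>bump'\<close>, which is evaluated by parts; the right half is symmetric. The total cost on the right-hand
  side tends to 0 when the bumps tend to the indicator of the interval.
\<close>

lemma bump_weighted_mean:
  fixes u :: "real \<Rightarrow> real"
  assumes u: "L-lipschitz_on {a..b} u" and "a < b"
  shows "\<bar>u a - u b\<bar> * bump a b n ((a + b) / 2) - \<bar>integral {a..b} (\<lambda>x. u x * bump' a b n x)\<bar>
    \<le> L * ((b - a) * bump a b n ((a + b) / 2) - integral {a..b} (bump a b n))"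
proof -
  define c where "c = (a + b) / 2"
  define \<psi> where "\<psi> = bump a b n"
  define \<psi>' where "\<psi>' = bump' a b n"
  have c: "a < c" "c < b" using \<open>a < b\<close> by (auto simp: c_def)
  have L: "0 \<le> L" using u lipschitz_on_nonneg by blast
  have d\<psi>: "(\<psi> has_real_derivative \<psi>' x) (at x)" for x
    unfolding \<psi>_def \<psi>'_def by (rule bump_has_derivative)
  have \<psi>ab: "\<psi> a = 0" "\<psi> b = 0"
    by (simp_all add: \<psi>_def bump_def flat_def)
  have cont\<psi>: "continuous_on S \<psi>" for S
    using d\<psi> by (meson DERIV_isCont continuous_at_imp_continuous_on)
  have cont\<psi>': "continuous_on S \<psi>'" for S
  proof -
    have flatc: "continuous_on UNIV (flat k)" for k
      using flat_has_derivative by (meson DERIV_isCont continuous_at_imp_continuous_on)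
    show ?thesis unfolding \<psi>'_def bump'_def
      by (intro continuous_intros continuous_on_compose2[OF flatc]) auto
  qed
  have contu: "continuous_on S u" if "S \<subseteq> {a..b}" for S
    using lipschitz_on_continuous_on[OF u] continuous_on_subset that by blast
  have int: "(\<lambda>x. u x * \<psi>' x) integrable_on {p..q}" "\<psi> integrable_on {p..q}"
    "(\<lambda>x. (u x - k) * \<psi>' x) integrable_on {p..q}" "(\<lambda>x. (x - k) * \<psi>' x) integrable_on {p..q}"
    "\<psi>' integrable_on {p..q}"
    if "a \<le> p" "q \<le> b" for p q k
    using that by (intro integrable_continuous_real continuous_intros contu cont\<psi> cont\<psi>'; auto)+
  have \<psi>'_int: "integral {p..q} \<psi>' = \<psi> q - \<psi> p" if "p \<le> q" for p q
    using that d\<psi> by (intro integral_unique fundamental_theorem_of_calculus)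
      (auto simp: has_real_derivative_iff_has_vector_derivative[symmetric] has_field_derivative_at_within)
  have moment: "integral {p..q} (\<lambda>x. (x - k) * \<psi>' x) = (q - k) * \<psi> q - (p - k) * \<psi> p - integral {p..q} \<psi>"
    if "a \<le> p" "p \<le> q" "q \<le> b" for p q k
  proof -
    have "((\<lambda>x. (x - k) * \<psi>' x + \<psi> x) has_integral (q - k) * \<psi> q - (p - k) * \<psi> p) {p..q}"
    proof (rule fundamental_theorem_of_calculus[OF \<open>p \<le> q\<close>])
      fix x
      have "((\<lambda>x. (x - k) * \<psi> x) has_real_derivative (x - k) * \<psi>' x + \<psi> x) (at x)"
        by (auto intro!: derivative_eq_intros d\<psi>)
      then show "((\<lambda>x. (x - k) * \<psi> x) has_vector_derivative (x - k) * \<psi>' x + \<psi> x) (at x within {p..q})"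
        by (simp add: has_real_derivative_iff_has_vector_derivative[symmetric] has_field_derivative_at_within)
    qed
    then show ?thesis
      using int(2,4)[OF that(1,3)] by (auto dest!: integral_unique simp: integral_add)
  qed
  have split: "integral {p..q} (\<lambda>x. (u x - k) * \<psi>' x) = integral {p..q} (\<lambda>x. u x * \<psi>' x) - k * (\<psi> q - \<psi> p)"
    if "a \<le> p" "p \<le> q" "q \<le> b" for p q k
    using integral_diff[OF int(1)[OF that(1,3)] integrable_on_mult_right[OF int(5)[OF that(1,3)], of k]]
      \<psi>'_int[OF that(2)] by (simp add: left_diff_distrib)
  have left: "\<bar>integral {a..c} (\<lambda>x. u x * \<psi>' x) - u a * \<psi> c\<bar> \<le> L * ((c - a) * \<psi> c - integral {a..c} \<psi>)"
  proof -
    have "norm (integral {a..c} (\<lambda>x. (u x - u a) * \<psi>' x)) \<le> integral {a..c} (\<lambda>x. L * ((x - a) * \<psi>' x))"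
    proof (rule integral_norm_bound_integral)
      show "(\<lambda>x. L * ((x - a) * \<psi>' x)) integrable_on {a..c}"
        using c by (intro integrable_on_mult_right int(4)) auto
      fix x assume x: "x \<in> {a..c}"
      then have "0 \<le> \<psi>' x"
        unfolding \<psi>'_def by (intro bump'_nonneg) (auto simp: c_def field_simps)
      moreover have "\<bar>u x - u a\<bar> \<le> L * (x - a)"
        using lipschitz_onD[OF u, of x a] x c by (simp add: dist_real_def)
      ultimately show "norm ((u x - u a) * \<psi>' x) \<le> L * ((x - a) * \<psi>' x)"
        using mult_right_mono by (fastforce simp: abs_mult)
    qed (use c in \<open>auto intro!: int\<close>)
    also have "\<dots> = L * ((c - a) * \<psi> c - integral {a..c} \<psi>)"
      using moment[of a c a] c by (simp add: \<psi>ab)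
    finally show ?thesis using split[of a c "u a"] c by (simp add: \<psi>ab)
  qed
  have right: "\<bar>integral {c..b} (\<lambda>x. u x * \<psi>' x) + u b * \<psi> c\<bar> \<le> L * ((b - c) * \<psi> c - integral {c..b} \<psi>)"
  proof -
    have "norm (integral {c..b} (\<lambda>x. (u x - u b) * \<psi>' x)) \<le> integral {c..b} (\<lambda>x. L * ((x - b) * \<psi>' x))"
    proof (rule integral_norm_bound_integral)
      show "(\<lambda>x. L * ((x - b) * \<psi>' x)) integrable_on {c..b}"
        using c by (intro integrable_on_mult_right int(4)) auto
      fix x assume x: "x \<in> {c..b}"
      then have "\<psi>' x \<le> 0"
        unfolding \<psi>'_def by (intro bump'_nonpos) (auto simp: c_def field_simps)
      moreover have "\<bar>u x - u b\<bar> \<le> L * (b - x)"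
        using lipschitz_onD[OF u, of x b] x c by (simp add: dist_real_def)
      ultimately have "\<bar>u x - u b\<bar> * - \<psi>' x \<le> L * (b - x) * - \<psi>' x"
        by (intro mult_right_mono) auto
      moreover have "L * (b - x) * - \<psi>' x = L * ((x - b) * \<psi>' x)"
        by (simp add: algebra_simps)
      ultimately show "norm ((u x - u b) * \<psi>' x) \<le> L * ((x - b) * \<psi>' x)"
        using \<open>\<psi>' x \<le> 0\<close> by (simp add: abs_mult)
    qed (use c in \<open>auto intro!: int\<close>)
    also have "\<dots> = L * ((b - c) * \<psi> c - integral {c..b} \<psi>)"
      unfolding integral_mult_right using c by (subst moment) (auto simp: \<psi>ab algebra_simps)
    finally show ?thesis using split[of c b "u b"] c by (simp add: \<psi>ab)
  qed
  have "\<psi> c \<ge> 0" unfolding \<psi>_def by (rule bump_bounds)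
  then have "\<bar>u a - u b\<bar> * \<psi> c = \<bar>u a * \<psi> c - u b * \<psi> c\<bar>"
    by (simp add: left_diff_distrib[symmetric] abs_mult)
  moreover have "integral {a..b} (\<lambda>x. u x * \<psi>' x) = integral {a..c} (\<lambda>x. u x * \<psi>' x) + integral {c..b} (\<lambda>x. u x * \<psi>' x)"
    "integral {a..b} \<psi> = integral {a..c} \<psi> + integral {c..b} \<psi>"
    using c by (intro Henstock_Kurzweil_Integration.integral_combine[symmetric] int; simp)+
  ultimately show ?thesis
    using left right unfolding c_def[symmetric] \<psi>_def[symmetric] \<psi>'_def[symmetric]
    by (simp add: algebra_simps)
qed

text \<open>
  A du Bois-Reymond lemma. The integrals against \<open>bump'\<close> are 0, so that \<open>bump_weighted_mean\<close> bounds
  \<open>\<bar>u a - u b\<bar>\<close> by quantities that vanish in the limit.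
\<close>

lemma zero_weak_deriv_imp_equal:
  assumes u: "L-lipschitz_on {0..s} u" and "0 < a" "a < b" "b < s"
    and weak: "\<And>\<phi>. \<phi> \<in> test_funs s \<Longrightarrow> integral {0..s} (\<lambda>x. u x * deriv \<phi> x) = 0"
  shows "u a = u b"
proof -
  have ub: "L-lipschitz_on {a..b} u"
    by (rule lipschitz_on_subset[OF u]) (use assms in auto)
  have d: "deriv (bump a b n) = bump' a b n" for n
    by (intro ext DERIV_imp_deriv bump_has_derivative)
  have "integral {a..b} (\<lambda>x. u x * bump' a b n x) = 0" for n
  proof -
    have "{a..b} \<inter> {0..s} = {a..b}" using assms by auto
    then have "integral {a..b} (\<lambda>x. u x * bump' a b n x) = integral {0..s} (\<lambda>x. if x \<in> {a..b} then u x * bump' a b n x else 0)"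
      using Henstock_Kurzweil_Integration.integral_restrict_Int[of "{0..s}" "{a..b}" "\<lambda>x. u x * bump' a b n x"] by (simp only:)
    also have "\<dots> = integral {0..s} (\<lambda>x. u x * deriv (bump a b n) x)"
      by (intro integral_cong) (auto simp: d bump'_eq_0)
    also have "\<dots> = 0"
      using assms by (intro weak bump_in_test_funs)
    finally show ?thesis .
  qed
  then have est: "\<bar>u a - u b\<bar> * bump a b n ((a + b) / 2)
      \<le> L * ((b - a) * bump a b n ((a + b) / 2) - integral {a..b} (bump a b n))" for n
    using bump_weighted_mean[OF ub \<open>a < b\<close>, of n] by simp
  have mid: "(\<lambda>n. bump a b n ((a + b) / 2)) \<longlonglongrightarrow> 1"
    using \<open>a < b\<close> by (intro bump_tendsto) auto
  have "(\<lambda>n. integral {a..b} (bump a b n)) \<longlonglongrightarrow> integral {a..b} (\<lambda>x. if x \<in> {a<..<b} then 1 else 0)"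
  proof (rule dominated_convergence(2)[where h = "\<lambda>x. 1"])
    show "bump a b n integrable_on {a..b}" for n
      using bump_has_derivative
      by (intro integrable_continuous_real) (meson DERIV_isCont continuous_at_imp_continuous_on)
    show "norm (bump a b n x) \<le> 1" for n x
      using bump_bounds[of a b n x] by simp
    show "(\<lambda>n. bump a b n x) \<longlonglongrightarrow> (if x \<in> {a<..<b} then 1 else 0)" if "x \<in> {a..b}" for x
      using bump_tendsto[of a x b] that by (auto simp: bump_def flat_def)
  qed (intro integrable_continuous_real continuous_intros)
  moreover have "integral {a..b} (\<lambda>x. if x \<in> {a<..<b} then 1 else 0) = integral {a..b} (\<lambda>x. 1::real)"
    by (rule integral_spike[of "{a, b}"]) auto
  ultimately have "(\<lambda>n. integral {a..b} (bump a b n)) \<longlonglongrightarrow> b - a"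
    using \<open>a < b\<close> by simp
  then have "(\<lambda>n. L * ((b - a) * bump a b n ((a + b) / 2) - integral {a..b} (bump a b n))) \<longlonglongrightarrow> L * ((b - a) * 1 - (b - a))"
    by (intro tendsto_intros mid)
  moreover have "(\<lambda>n. \<bar>u a - u b\<bar> * bump a b n ((a + b) / 2)) \<longlonglongrightarrow> \<bar>u a - u b\<bar> * 1"
    by (intro tendsto_intros mid)
  ultimately have "\<bar>u a - u b\<bar> * 1 \<le> L * ((b - a) * 1 - (b - a))"
    using est by (intro LIMSEQ_le) auto
  then show ?thesis by simp
qed

text \<open>
  The primitive \<open>G\<close> of \<open>g\<close> has \<open>g\<close> both as its weak derivative and as its derivative almost
  everywhere. Hence \<open>f - G\<close> has weak derivative 0 and is constant.
\<close>

lemma weak_deriv_imp_ae_deriv: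
  assumes f: "L-lipschitz_on {0..s} f" and g: "g \<in> Linf s" and w: "has_weak_deriv s f g" and s: "0 < s"
  shows "ae_deriv s f g"
proof -
  define G where "G x = integral {0..x} g" for x
  have G: "ae_deriv s G g"
    unfolding G_def using Linf_antiderivative[OF g] s by simp
  obtain K where K: "K-lipschitz_on {0..s} G"
    using ae_deriv_lipschitz[OF G] by blast
  define u where "u x = f x - G x" for x
  have u: "(L + K)-lipschitz_on {0..s} u"
    unfolding u_def by (rule lipschitz_on_diff[OF f K])
  have fc: "continuous_on {0..s} f" and Gc: "continuous_on {0..s} G" and uc: "continuous_on {0..s} u"
    using f K u lipschitz_on_continuous_on by blast+
  have "integral {0..s} (\<lambda>x. u x * deriv \<phi> x) = 0" if \<phi>: "\<phi> \<in> test_funs s" for \<phi>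
  proof -
    have L: "(\<lambda>x. f x * deriv \<phi> x) \<in> Linf s" "(\<lambda>x. G x * deriv \<phi> x) \<in> Linf s"
      using fc Gc continuous_on_subset[OF test_funD(2)[OF \<phi>]]
      by (auto intro: Linf_mult continuous_imp_Linf)
    have "(LINT x|lebesgue_on {0..s}. f x * deriv \<phi> x) = (LINT x|lebesgue_on {0..s}. G x * deriv \<phi> x)"
      using w ae_deriv_imp_weak_deriv[OF G] \<phi> s unfolding has_weak_deriv_def by simp
    then have "integral {0..s} (\<lambda>x. f x * deriv \<phi> x) = integral {0..s} (\<lambda>x. G x * deriv \<phi> x)"
      unfolding L[THEN Linf_lebesgue_integral] .
    then show ?thesis
      using integral_diff[OF L[THEN Linf_integrable]] by (simp add: u_def left_diff_distrib)
  qed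
  then have const: "u a = u b" if "0 < a" "a < b" "b < s" for a b
    using zero_weak_deriv_imp_equal[OF u that] by blast
  define m where "m = s / 2"
  have m: "0 < m" "m < s" using s by (auto simp: m_def)
  have inner: "u x = u m" if "x \<in> {0<..<s}" for x
  proof (cases x m rule: linorder_cases)
    case less
    show ?thesis by (rule const) (use that m less in auto)
  next
    case greater
    show ?thesis by (rule const[symmetric]) (use that m greater in auto)
  qed simp
  have "AE x in lebesgue_on {0..s}. (f has_real_derivative g x) (at x)"
    using ae_derivD[OF G] AE_lebesgue_on_interior
  proof eventually_elim
    case (elim x)
    have "((\<lambda>x. G x + u m) has_real_derivative g x) (at x)"
      using DERIV_add[OF elim(1) DERIV_const[of "u m"]] by simp
    then show ?case
    proof (rule has_field_derivative_transform_within_open[of _ _ _ "{0<..<s}"])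
      show "G y + u m = f y" if "y \<in> {0<..<s}" for y
        using inner[OF that] by (simp add: u_def)
    qed (use elim in auto)
  qed
  then show ?thesis using f unfolding ae_deriv_def by blast
qed

lemma W1inf_imp_ae_deriv:
  assumes "f \<in> W1inf s" "0 < s"
  shows "ae_deriv s f (wderiv s f)"
proof -
  have "\<exists>g. g \<in> Linf s \<and> has_weak_deriv s f g"
    using assms(1) unfolding W1inf_def by blast
  from someI_ex[OF this] have "wderiv s f \<in> Linf s" "has_weak_deriv s f (wderiv s f)"
    unfolding wderiv_def by auto
  then show ?thesis
    using assms weak_deriv_imp_ae_deriv unfolding W1inf_def by blast
qed

lemma ae_deriv_imp_W1inf:
  assumes "ae_deriv s f g" "0 < s"
  shows "f \<in> W1inf s"
  using assms ae_deriv_imp_weak_deriv[OF assms(1)] ae_deriv_Linf[OF assms(1)] ae_deriv_lipschitz[OF assms(1)]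
    continuous_imp_Linf[OF ae_deriv_continuous[OF assms(1)]]
  unfolding W1inf_def by force

lemma ae_deriv_wderiv:
  assumes "ae_deriv s f g" "0 < s"
  shows "AE x in lebesgue_on {0..s}. wderiv s f x = g x"
  using ae_deriv_unique[OF W1inf_imp_ae_deriv[OF ae_deriv_imp_W1inf[OF assms] assms(2)] assms(1)] .

section \<open>Pointwise minima and running minima\<close>

text \<open>
  Each point isolated from the left claims a rational in its gap, and different points claim different
  rationals, because the gap of the larger point does not contain the smaller one.
\<close>

lemma countable_left_isolated:
  fixes Z :: "real set"
  shows "countable {x \<in> Z. \<exists>q<x. {q<..<x} \<inter> Z = {}}"
proof -
  define I where "I = {x \<in> Z. \<exists>q<x. {q<..<x} \<inter> Z = {}}"
  have "\<exists>q\<in>\<rat>. q < x \<and> {q<..<x} \<inter> Z = {}" if xI: "x \<in> I" for x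
  proof -
    obtain p where p: "p < x" "{p<..<x} \<inter> Z = {}"
      using xI unfolding I_def by blast
    obtain q where q: "q \<in> \<rat>" "p < q" "q < x"
      using Rats_dense_in_real[OF p(1)] by blast
    have "{q<..<x} \<subseteq> {p<..<x}" using q by auto
    then show ?thesis using p q by blast
  qed
  then obtain q where q: "\<And>x. x \<in> I \<Longrightarrow> q x \<in> \<rat> \<and> q x < x \<and> {q x<..<x} \<inter> Z = {}"
    by metis
  have "inj_on q I"
  proof (rule linorder_inj_onI)
    fix x y assume xy: "x < y" "x \<in> I" "y \<in> I"
    have "x \<notin> {q y<..<y}" using q[OF xy(3)] xy(2) unfolding I_def by blast
    then show "q x \<noteq> q y" using q[OF xy(2)] xy(1) by auto
  qed auto
  moreover have "q ` I \<subseteq> \<rat>"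
    using q by blast
  then have "countable (q ` I)"
    using countable_rat countable_subset by blast
  ultimately show ?thesis
    unfolding I_def[symmetric] using countable_image_inj_on by blast
qed

lemma AE_left_accumulation:
  fixes Z :: "real set"
  shows "AE x in lebesgue_on {a..b}. x \<in> Z \<longrightarrow> (\<forall>q<x. {q<..<x} \<inter> Z \<noteq> {})"
proof (rule AE_lebesgue_on_negligibleI)
  show "negligible {x \<in> Z. \<exists>q<x. {q<..<x} \<inter> Z = {}}"
    using countable_imp_null_set_lborel[OF countable_left_isolated[of Z]]
    by (simp add: negligible_iff_null_sets null_sets_completionI)
qed blast

lemma DERIV_zero_at_left_accumulation:
  assumes "(d has_real_derivative k) (at x)" "d x = 0"
    and acc: "\<And>q. q < x \<Longrightarrow> \<exists>z. d z = 0 \<and> q < z \<and> z < x"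
  shows "k = 0"
proof (rule ccontr)
  assume "k \<noteq> 0"
  have "((\<lambda>y. (d y - d x) / (y - x)) \<longlongrightarrow> k) (at_left x)"
    using assms(1) unfolding has_field_derivative_iff by (rule filterlim_mono) (auto simp: at_le)
  then have "\<forall>\<^sub>F y in at_left x. (d y - d x) / (y - x) \<noteq> 0"
    using \<open>k \<noteq> 0\<close> by (rule tendsto_imp_eventually_ne)
  then obtain b where "b < x" "\<And>y. b < y \<Longrightarrow> y < x \<Longrightarrow> (d y - d x) / (y - x) \<noteq> 0"
    unfolding eventually_at_left_field by blast
  then show False
    using acc[of b] \<open>d x = 0\<close> by fastforce
qed

text \<open>
  At almost every point where \<open>f\<close> and \<open>u\<close> agree there are further such points arbitrarily close, and
  they force the derivative of \<open>f - u\<close> to be 0.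
\<close>

lemma ae_deriv_eq_on_coincidence:
  assumes "ae_deriv s f g" "ae_deriv s u v"
  shows "AE x in lebesgue_on {0..s}. f x = u x \<longrightarrow> g x = v x"
  using ae_derivD[OF ae_deriv_diff[OF assms]] AE_left_accumulation[of "{x. f x - u x = 0}" 0 s]
proof eventually_elim
  case (elim x)
  show ?case
  proof
    assume eq: "f x = u x"
    have "\<exists>z. f z - u z = 0 \<and> q < z \<and> z < x" if "q < x" for q
    proof -
      have "{q<..<x} \<inter> {x. f x - u x = 0} \<noteq> {}"
        using elim(2) eq that by simp
      then show ?thesis by auto
    qed
    then show "g x = v x"
      using DERIV_zero_at_left_accumulation[OF elim(1)] eq by simp
  qed
qed

lemma ae_deriv_min:
  assumes "ae_deriv s f g" "ae_deriv s u v"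
  shows "ae_deriv s (\<lambda>x. min (f x) (u x)) (\<lambda>x. if f x < u x then g x else v x)"
proof -
  obtain K L where KL: "K-lipschitz_on {0..s} f" "L-lipschitz_on {0..s} u"
    using assms[THEN ae_deriv_lipschitz] by blast
  then have KL0: "0 \<le> K" "0 \<le> L" using lipschitz_on_nonneg by blast+
  have "(K + L)-lipschitz_on {0..s} (\<lambda>x. min (f x) (u x))"
  proof (rule lipschitz_onI)
    fix x y assume xy: "x \<in> {0..s}" "y \<in> {0..s}"
    have "dist (min (f x) (u x)) (min (f y) (u y)) \<le> dist (f x) (f y) + dist (u x) (u y)"
      unfolding dist_real_def by linarith
    also have "\<dots> \<le> (K + L) * dist x y"
      using lipschitz_onD[OF KL(1) xy] lipschitz_onD[OF KL(2) xy] by (simp add: distrib_right)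
    finally show "dist (min (f x) (u x)) (min (f y) (u y)) \<le> (K + L) * dist x y" .
  qed (use KL0 in simp)
  moreover have "AE x in lebesgue_on {0..s}.
    ((\<lambda>x. min (f x) (u x)) has_real_derivative (if f x < u x then g x else v x)) (at x)"
    using assms[THEN ae_derivD] ae_deriv_eq_on_coincidence[OF assms] AE_lebesgue_on_interior
  proof eventually_elim
    case (elim x)
    have cont: "isCont f x" "isCont u x" using elim(1,2) DERIV_isCont by blast+
    consider "f x < u x" | "u x < f x" | "f x = u x" by linarith
    then show ?case
    proof cases
      case 1
      have "\<forall>\<^sub>F y in nhds x. f y < u y"
      proof -
        have "((\<lambda>y. u y - f y) \<longlongrightarrow> u x - f x) (nhds x)"
          using cont by (intro tendsto_diff) (simp_all add: isCont_def tendsto_at_iff_tendsto_nhds)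
        from order_tendstoD(1)[OF this, of 0] 1 show ?thesis by simp
      qed
      then have "\<forall>\<^sub>F y in nhds x. min (f y) (u y) = f y" by eventually_elim simp
      then show ?thesis using 1 elim(1) by (subst DERIV_cong_ev[OF refl _ refl]) auto
    next
      case 2
      have "\<forall>\<^sub>F y in nhds x. u y < f y"
      proof -
        have "((\<lambda>y. f y - u y) \<longlongrightarrow> f x - u x) (nhds x)"
          using cont by (intro tendsto_diff) (simp_all add: isCont_def tendsto_at_iff_tendsto_nhds)
        from order_tendstoD(1)[OF this, of 0] 2 show ?thesis by simp
      qed
      then have "\<forall>\<^sub>F y in nhds x. min (f y) (u y) = u y" by eventually_elim simp
      then show ?thesis using 2 elim(2) by (subst DERIV_cong_ev[OF refl _ refl]) auto
    next
      case 3
      then have "g x = v x" using elim by simp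
      have "((\<lambda>y. min (f y) (u y)) has_real_derivative v x) (at x)"
        unfolding has_field_derivative_def has_derivative_at_alt
      proof (intro conjI allI impI)
        fix e :: real assume "0 < e"
        obtain d1 where d1: "d1 > 0" "\<And>y. norm (y - x) < d1 \<Longrightarrow> norm (f y - f x - v x * (y - x)) \<le> e * norm (y - x)"
          using elim(1) \<open>0 < e\<close> unfolding \<open>g x = v x\<close> has_field_derivative_def has_derivative_at_alt by blast
        obtain d2 where d2: "d2 > 0" "\<And>y. norm (y - x) < d2 \<Longrightarrow> norm (u y - u x - v x * (y - x)) \<le> e * norm (y - x)"
          using elim(2) \<open>0 < e\<close> unfolding has_field_derivative_def has_derivative_at_alt by blast
        have "norm (min (f y) (u y) - min (f x) (u x) - v x * (y - x)) \<le> e * norm (y - x)"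
          if "norm (y - x) < min d1 d2" for y
          using d1(2)[of y] d2(2)[of y] that 3 by (cases "f y \<le> u y") (simp_all add: min_absorb1 min_absorb2)
        then show "\<exists>d>0. \<forall>y. norm (y - x) < d \<longrightarrow>
            norm (min (f y) (u y) - min (f x) (u x) - v x * (y - x)) \<le> e * norm (y - x)"
          using d1(1) d2(1) by (intro exI[of _ "min d1 d2"]) auto
      qed (rule bounded_linear_mult_right)
      then show ?thesis using 3 by simp
    qed
  qed
  ultimately show ?thesis unfolding ae_deriv_def by blast
qed

definition running_min :: "(real \<Rightarrow> real) \<Rightarrow> real \<Rightarrow> real" where
  "running_min h x = Inf (h ` {0..x})"

lemma running_min_attained:
  assumes "continuous_on {0..s} h" "x \<in> {0..s}"
  obtains w where "w \<in> {0..x}" "running_min h x = h w" "\<And>y. y \<in> {0..x} \<Longrightarrow> h w \<le> h y"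
proof -
  have "continuous_on {0..x} h"
    using assms continuous_on_subset by fastforce
  then obtain w where w: "w \<in> {0..x}" "\<And>y. y \<in> {0..x} \<Longrightarrow> h w \<le> h y"
    using continuous_attains_inf[of "{0..x}" h] assms(2) by auto
  then have "running_min h x = h w"
    unfolding running_min_def by (intro cInf_eq_minimum) auto
  then show ?thesis using w that by blast
qed

lemma running_min_le:
  assumes "continuous_on {0..s} h" "x \<in> {0..s}" "y \<in> {0..x}"
  shows "running_min h x \<le> h y"
  by (rule running_min_attained[OF assms(1,2)]) (use assms(3) in simp)

lemma running_min_antimono:
  assumes "continuous_on {0..s} h" "0 \<le> x" "x \<le> y" "y \<le> s"
  shows "running_min h y \<le> running_min h x"
proof -
  obtain w where "w \<in> {0..x}" "running_min h x = h w"
    by (rule running_min_attained[OF assms(1), of x]) (use assms in auto)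
  then show ?thesis
    using running_min_le[OF assms(1), of y w] assms by simp
qed

lemma running_min_lipschitz:
  assumes h: "L-lipschitz_on {0..s} h"
  shows "L-lipschitz_on {0..s} (running_min h)"
proof (rule lipschitz_on_leI)
  have c: "continuous_on {0..s} h" using h by (rule lipschitz_on_continuous_on)
  show L: "0 \<le> L" using h by (rule lipschitz_on_nonneg)
  fix x y assume xy: "x \<in> {0..s}" "y \<in> {0..s}" "x \<le> y"
  obtain w where w: "w \<in> {0..y}" "running_min h y = h w"
    by (rule running_min_attained[OF c xy(2)])
  have "running_min h x - L * (y - x) \<le> h w"
  proof (cases "w \<le> x")
    case True
    then show ?thesis
      using running_min_le[OF c xy(1), of w] w L xy by (smt (verit) atLeastAtMost_iff mult_nonneg_nonneg)
  next
    case False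
    have "h x - h w \<le> L * (w - x)"
      using lipschitz_onD[OF h, of x w] False w xy by (auto simp: dist_real_def)
    also have "\<dots> \<le> L * (y - x)" using w L by (intro mult_left_mono) auto
    finally show ?thesis using running_min_le[OF c xy(1), of x] xy by simp
  qed
  then show "dist (running_min h x) (running_min h y) \<le> L * dist x y"
    using running_min_antimono[OF c, of x y] xy w by (simp add: dist_real_def)
qed

text \<open>
  Below the graph of \<open>h\<close> the minimum is attained earlier, so moving \<open>x\<close> slightly has no effect on it.
\<close>

lemma running_min_locally_constant:
  assumes c: "continuous_on {0..s} h" "continuous_on {0..s} (running_min h)"
    and x: "0 < x" "x < s" "running_min h x < h x"
  shows "(running_min h has_real_derivative 0) (at x)"
proof -
  \<comment> \<open>A level separating h from its running minimum on a whole neighbourhood of x.\<close>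
  define p where "p = (running_min h x + h x) / 2"
  have p: "running_min h x < p" "p < h x" using x by (auto simp: p_def)
  have "isCont h x" "isCont (running_min h) x"
    using c x by (auto intro!: continuous_on_interior)
  then have "\<forall>\<^sub>F y in nhds x. p < h y" "\<forall>\<^sub>F y in nhds x. running_min h y < p"
    using p unfolding isCont_def tendsto_at_iff_tendsto_nhds by (auto intro: order_tendstoD)
  then have "\<forall>\<^sub>F y in nhds x. p < h y \<and> running_min h y < p"
    by eventually_elim simp
  then obtain e where e: "e > 0" "\<And>y. dist y x < e \<Longrightarrow> p < h y \<and> running_min h y < p"
    unfolding eventually_nhds_metric by blast
  define e' where "e' = min e (min x (s - x))"
  have e': "e' > 0" "e' \<le> e" "e' \<le> x" "e' \<le> s - x" using e x by (auto simp: e'_def)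
  have le: "running_min h y \<le> running_min h z" if near: "y \<le> z" "dist y x < e'" "dist z x < e'" for y z
  proof -
    have yz: "0 \<le> y" "z \<le> s" using near e' by (auto simp: dist_real_def)
    obtain w where w: "w \<in> {0..z}" "running_min h z = h w"
      by (rule running_min_attained[OF c(1), of z]) (use near yz in auto)
    have "w \<le> y"
    proof (rule ccontr)
      assume "\<not> w \<le> y"
      then have "dist w x < e" using w that e' by (auto simp: dist_real_def)
      then have "p < h w" using e by blast
      moreover have "running_min h z < p" using e that e' by simp
      ultimately show False using w by simp
    qed
    then show ?thesis using running_min_le[OF c(1), of y w] w yz that by simp
  qed
  have const: "running_min h y = running_min h x" if "dist y x < e'" for y
  proof -
    have "0 \<le> y" "y \<le> s" using that e' by (auto simp: dist_real_def)
    then show ?thesis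
      using le[of x y] le[of y x] that e' x running_min_antimono[OF c(1), of x y] running_min_antimono[OF c(1), of y x]
      by (cases "x \<le> y") auto
  qed
  show ?thesis
  proof (rule has_field_derivative_transform_within_open[OF DERIV_const])
    show "open (ball x e')" by simp
    show "x \<in> ball x e'" using e' by simp
  qed (use const in \<open>simp add: dist_commute\<close>)
qed

text \<open>
  Where the running minimum touches \<open>h\<close>, the function \<open>h\<close> cannot be increasing. To the right of \<open>x\<close> the
  running minimum then follows the descent of \<open>h\<close>. To the left it could be constant, as when \<open>h\<close>
  returns to an old minimum; this is excluded by contact points \<open>z < x\<close> close to \<open>x\<close>, since on \<open>[z, x]\<close>
  the running minimum depends only on the values of \<open>h\<close> from \<open>z\<close> on.
\<close>

lemma running_min_DERIV_at_contact:
  assumes c: "continuous_on {0..s} h" and x: "0 < x" "x < s" "running_min h x = h x"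
    and d: "(h has_real_derivative d) (at x)"
    and acc: "\<And>q. q < x \<Longrightarrow> \<exists>z\<in>{0..s}. running_min h z = h z \<and> q < z \<and> z < x"
  shows "d \<le> 0 \<and> (running_min h has_real_derivative d) (at x)"
proof
  have h_ge: "h x \<le> h w" if "0 \<le> w" "w \<le> x" for w
    using running_min_le[OF c, of x w] x that by simp
  have "((\<lambda>y. (h y - h x) / (y - x)) \<longlongrightarrow> d) (at_left x)"
    using d unfolding has_field_derivative_iff by (rule filterlim_mono) (auto simp: at_le)
  moreover have "\<forall>\<^sub>F y in at_left x. (h y - h x) / (y - x) \<le> 0"
    unfolding eventually_at_left_field using x h_ge
    by (intro exI[of _ 0]) (auto simp: divide_le_0_iff)
  ultimately show "d \<le> 0"
    by (rule tendsto_upperbound) simp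
  show "(running_min h has_real_derivative d) (at x)"
    unfolding has_field_derivative_def has_derivative_at_alt
  proof (intro conjI allI impI)
    fix e :: real assume "0 < e"
    obtain r where r: "r > 0" "\<And>y. norm (y - x) < r \<Longrightarrow> norm (h y - h x - d * (y - x)) \<le> e * norm (y - x)"
      using d \<open>0 < e\<close> unfolding has_field_derivative_def has_derivative_at_alt by blast
    obtain z where z: "z \<in> {0..s}" "running_min h z = h z" "x - r < z" "z < x"
      using acc[of "x - r"] r(1) by auto
    have right: "h x + (d - e) * (w - x) \<le> h w" "h w \<le> h x + (d + e) * (w - x)" if "x \<le> w" "w < x + r" for w
      using r(2)[of w] that by (auto simp: abs_le_iff algebra_simps)
    have left: "h x + (- d - e) * (x - w) \<le> h w" "h w \<le> h x + (- d + e) * (x - w)" if "w \<le> x" "x - r < w" for w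
      using r(2)[of w] that by (auto simp: abs_le_iff algebra_simps)
    have "norm (running_min h y - running_min h x - d * (y - x)) \<le> e * norm (y - x)"
      if y: "norm (y - x) < min (min r (x - z)) (s - x)" for y
    proof -
      have ys: "z < y" "y < x + r" "y \<in> {0..s}" using y z by auto
      obtain w where w: "w \<in> {0..y}" "running_min h y = h w"
        by (rule running_min_attained[OF c ys(3)])
      have up: "running_min h y \<le> h y" using running_min_le[OF c ys(3)] ys by simp
      show ?thesis
      proof (cases "x \<le> y")
        case True
        have "h x + (d - e) * (y - x) \<le> h w"
        proof (cases "w \<le> x")
          case True
          have "(d - e) * (y - x) \<le> 0" using \<open>d \<le> 0\<close> \<open>0 < e\<close> \<open>x \<le> y\<close> by (intro mult_nonpos_nonneg) auto
          then show ?thesis using h_ge[of w] w True by simp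
        next
          case False
          have "(d - e) * (y - x) \<le> (d - e) * (w - x)"
            using \<open>d \<le> 0\<close> \<open>0 < e\<close> w by (intro mult_left_mono_neg) auto
          then show ?thesis using right(1)[of w] False w ys by simp
        qed
        then show ?thesis
          using right(2)[of y] up True ys w x by (auto simp: abs_le_iff algebra_simps)
      next
        case False
        \<comment> \<open>At a contact point z the value h z is the minimum so far, so minimizers before z may be moved to z.\<close>
        define w' where "w' = max w z"
        have w': "z \<le> w'" "w' \<le> y" "h w' \<le> h w"
          using running_min_le[OF c z(1), of w] z w ys by (auto simp: w'_def max_def)
        have "h x + (- d - e) * (x - y) \<le> h w"
        proof (cases "0 \<le> - d - e")
          case True
          then have "(- d - e) * (x - y) \<le> (- d - e) * (x - w')"
            using w' by (intro mult_left_mono) auto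
          then show ?thesis using left(1)[of w'] w' z False by simp
        next
          case neg: False
          then have "(- d - e) * (x - y) \<le> 0" using False by (intro mult_nonpos_nonneg) auto
          then show ?thesis using h_ge[of w] w False by simp
        qed
        then show ?thesis
          using left(2)[of y] up False ys z w x by (auto simp: abs_le_iff algebra_simps)
      qed
    qed
    then show "\<exists>r>0. \<forall>y. norm (y - x) < r \<longrightarrow>
        norm (running_min h y - running_min h x - d * (y - x)) \<le> e * norm (y - x)"
      using r(1) z x by (intro exI[of _ "min (min r (x - z)) (s - x)"]) auto
  qed (rule bounded_linear_mult_right)
qed

lemma ae_deriv_running_min:
  assumes "ae_deriv s h k"
  shows "ae_deriv s (running_min h) (\<lambda>x. if running_min h x < h x then 0 else min 0 (k x))"
proof -
  obtain L where L: "L-lipschitz_on {0..s} h"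
    using ae_deriv_lipschitz[OF assms] by blast
  note c = lipschitz_on_continuous_on[OF L] lipschitz_on_continuous_on[OF running_min_lipschitz[OF L]]
  have "AE x in lebesgue_on {0..s}. (running_min h has_real_derivative
      (if running_min h x < h x then 0 else min 0 (k x))) (at x)"
    using ae_derivD[OF assms] AE_lebesgue_on_interior[of 0 s]
      AE_left_accumulation[of "{z \<in> {0..s}. running_min h z = h z}" 0 s]
  proof eventually_elim
    case (elim x)
    show ?case
    proof (cases "running_min h x < h x")
      case True
      then show ?thesis using running_min_locally_constant[OF c] elim(2) by simp
    next
      case False
      then have "running_min h x = h x"
        using running_min_le[OF c(1), of x x] elim(2) by simp
      moreover have "\<exists>z\<in>{0..s}. running_min h z = h z \<and> q < z \<and> z < x" if "q < x" for q
      proof -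
        have "{q<..<x} \<inter> {z \<in> {0..s}. running_min h z = h z} \<noteq> {}"
          using elim(2,3) \<open>running_min h x = h x\<close> that by simp
        then show ?thesis by auto
      qed
      ultimately have "k x \<le> 0 \<and> (running_min h has_real_derivative k x) (at x)"
        using running_min_DERIV_at_contact[OF c(1) _ _ _ elim(1)] elim(2) by blast
      then show ?thesis using False by (simp add: min_absorb2)
    qed
  qed
  then show ?thesis using running_min_lipschitz[OF L] unfolding ae_deriv_def by blast
qed

section \<open>Forward and backward solutions\<close>

text \<open>
  If \<open>u\<close> were positive at \<open>x\<close>, it would be positive from its last nonpositive point \<open>t\<close> before \<open>x\<close>
  onwards, hence could not grow between \<open>t\<close> and \<open>x\<close>.
\<close>

lemma nonpos_if_ae_deriv_nonpos_where_pos: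
  assumes u: "ae_deriv s u v" and u0: "u 0 \<le> 0" and sign: "AE x in lebesgue_on {0..s}. 0 < u x \<longrightarrow> v x \<le> 0"
    and x: "x \<in> {0..s}"
  shows "u x \<le> 0"
proof (rule ccontr)
  assume pos: "\<not> u x \<le> 0"
  define S where "S = {y \<in> {0..x}. u y \<le> 0}"
  have c: "continuous_on {0..x} u"
    by (rule continuous_on_subset[OF ae_deriv_continuous[OF u]]) (use x in auto)
  have "closed S"
    unfolding S_def by (intro continuous_on_closed_Collect_le c continuous_on_const) auto
  then have "compact S"
    using compact_Int_closed[of "{0..x}" S] by (simp add: S_def Int_absorb1 Int_def conj_commute cong: conj_cong)
  moreover have "0 \<in> S" using u0 x by (simp add: S_def)
  ultimately obtain t where t: "t \<in> S" "\<And>y. y \<in> S \<Longrightarrow> y \<le> t"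
    using compact_attains_sup[of S] by blast
  have t': "0 \<le> t" "t \<le> x" "u t \<le> 0" using t(1) by (auto simp: S_def)
  have above: "0 < u y" if y: "t < y" "y \<le> x" for y
  proof (rule ccontr)
    assume "\<not> 0 < u y"
    then have "y \<in> S" using y t' by (simp add: S_def)
    then show False using t(2) y by force
  qed
  obtain N where N: "negligible N" "\<And>y. y \<in> {0..s} - N \<Longrightarrow> 0 < u y \<longrightarrow> v y \<le> 0"
    using sign unfolding AE_lebesgue_on_iff_negligible by blast
  have "(v has_integral u x - u t) {t..x}"
    by (rule ae_deriv_ftc[OF u]) (use t' x in auto)
  then have "((\<lambda>y. if y \<in> insert t N then 0 else v y) has_integral u x - u t) {t..x}"
    by (rule has_integral_spike[rotated 2, of _ _ _ "insert t N"]) (use N(1) in auto)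
  then have "u x - u t \<le> 0"
  proof (rule has_integral_le[OF _ has_integral_0])
    fix y assume y: "y \<in> {t..x}"
    show "(if y \<in> insert t N then 0 else v y) \<le> 0"
      using N(2)[of y] above[of y] y t' x by auto
  qed
  then show False using t' pos by simp
qed

text \<open>
  This removes the chosen representative of the weak derivative from both differential equations, so
  that solutions can be handled pointwise.
\<close>

lemma wderiv_ae_deriv_iff:
  assumes "0 < s"
  shows "\<phi> \<in> W1inf s \<and> (AE x in lebesgue_on {0..s}. wderiv s \<phi> x = g x) \<longleftrightarrow> ae_deriv s \<phi> g"
  using assms ae_deriv_cong_AE[OF W1inf_imp_ae_deriv] ae_deriv_imp_W1inf ae_deriv_wderiv by blast

lemma forward_solution_iff:
  assumes "0 < s"
  shows "forward_solution s \<alpha> \<mu> \<phi> \<longleftrightarrow>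
    ae_deriv s \<phi> (\<lambda>x. if \<mu> x \<le> \<phi> x then min (\<alpha> x) (wderiv s \<mu> x) else \<alpha> x) \<and> \<phi> 0 = \<mu> 0"
  unfolding forward_solution_def wderiv_ae_deriv_iff[OF assms, symmetric] by blast

lemma backward_solution_iff:
  assumes "0 < s"
  shows "backward_solution s \<alpha> \<mu> \<phi> \<longleftrightarrow>
    ae_deriv s \<phi> (\<lambda>x. if \<mu> x \<le> \<phi> x then max (\<alpha> x) (wderiv s \<mu> x) else \<alpha> x) \<and> \<phi> s = \<mu> s"
  unfolding backward_solution_def wderiv_ae_deriv_iff[OF assms, symmetric] by blast

text \<open>
  The solution is \<open>A\<close> plus the running minimum of \<open>h = \<mu> - A\<close>. Contact of the running minimum with \<open>h\<close>
  means contact of \<open>\<phi>\<close> with \<open>\<mu>\<close>, and its slope \<open>min 0 (\<mu>' - \<alpha>)\<close> there adds up with \<open>\<alpha>\<close> to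
  \<open>min \<alpha> \<mu>'\<close>.
\<close>

lemma forward_solution_exists:
  assumes s: "0 < s" and \<alpha>: "\<alpha> \<in> Linf s" and \<mu>: "\<mu> \<in> W1inf s"
  shows "\<exists>\<phi>. forward_solution s \<alpha> \<mu> \<phi>"
proof -
  define A where "A x = integral {0..x} \<alpha>" for x
  have A: "ae_deriv s A \<alpha>"
    unfolding A_def using Linf_antiderivative[OF \<alpha>] s by simp
  define h where "h x = \<mu> x - A x" for x
  have h: "ae_deriv s h (\<lambda>x. wderiv s \<mu> x - \<alpha> x)"
    unfolding h_def by (rule ae_deriv_diff[OF W1inf_imp_ae_deriv[OF \<mu> s] A])
  define \<phi> where "\<phi> x = A x + running_min h x" for x
  have "ae_deriv s \<phi> (\<lambda>x. \<alpha> x + (if running_min h x < h x then 0 else min 0 (wderiv s \<mu> x - \<alpha> x)))"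
    unfolding \<phi>_def by (rule ae_deriv_add[OF A ae_deriv_running_min[OF h]])
  moreover have "(\<lambda>x. \<alpha> x + (if running_min h x < h x then 0 else min 0 (wderiv s \<mu> x - \<alpha> x)))
      = (\<lambda>x. if \<mu> x \<le> \<phi> x then min (\<alpha> x) (wderiv s \<mu> x) else \<alpha> x)"
    by (auto simp: fun_eq_iff \<phi>_def h_def min_def)
  moreover have "\<phi> 0 = \<mu> 0"
    by (simp add: \<phi>_def running_min_def h_def A_def)
  ultimately show ?thesis
    using forward_solution_iff[OF s] by metis
qed

lemma forward_solution_le:
  assumes s: "0 < s" and \<mu>: "\<mu> \<in> W1inf s" and \<phi>: "forward_solution s \<alpha> \<mu> \<phi>" and x: "x \<in> {0..s}"
  shows "\<phi> x \<le> \<mu> x"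
proof -
  have "\<phi> x - \<mu> x \<le> 0"
  proof (rule nonpos_if_ae_deriv_nonpos_where_pos[OF ae_deriv_diff[OF _ W1inf_imp_ae_deriv[OF \<mu> s]] _ _ x])
    show "ae_deriv s \<phi> (\<lambda>x. if \<mu> x \<le> \<phi> x then min (\<alpha> x) (wderiv s \<mu> x) else \<alpha> x)" "\<phi> 0 - \<mu> 0 \<le> 0"
      using \<phi> forward_solution_iff[OF s] by auto
  qed simp
  then show ?thesis by simp
qed

text \<open>
  Where \<open>w\<close> exceeds \<open>\<phi>\<close>, the solution is strictly below \<open>\<mu>\<close> and thus has slope \<open>\<alpha> \<ge> w'\<close>.
\<close>

lemma forward_solution_greatest:
  assumes s: "0 < s" and \<mu>: "\<mu> \<in> W1inf s" and \<phi>: "forward_solution s \<alpha> \<mu> \<phi>"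
    and w: "ae_deriv s w w'" "\<And>y. y \<in> {0..s} \<Longrightarrow> w y \<le> \<mu> y" "AE y in lebesgue_on {0..s}. w' y \<le> \<alpha> y"
    and x: "x \<in> {0..s}"
  shows "w x \<le> \<phi> x"
proof -
  have \<phi>': "ae_deriv s \<phi> (\<lambda>x. if \<mu> x \<le> \<phi> x then min (\<alpha> x) (wderiv s \<mu> x) else \<alpha> x)" "\<phi> 0 = \<mu> 0"
    using \<phi> forward_solution_iff[OF s] by auto
  have "w x - \<phi> x \<le> 0"
  proof (rule nonpos_if_ae_deriv_nonpos_where_pos[OF ae_deriv_diff[OF w(1) \<phi>'(1)] _ _ x])
    show "w 0 - \<phi> 0 \<le> 0" using w(2)[of 0] \<phi>'(2) s by simp
    show "AE y in lebesgue_on {0..s}. 0 < w y - \<phi> y \<longrightarrow>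
        w' y - (if \<mu> y \<le> \<phi> y then min (\<alpha> y) (wderiv s \<mu> y) else \<alpha> y) \<le> 0"
      using w(3) AE_lebesgue_on_interior
    proof eventually_elim
      case (elim y)
      then show ?case using w(2)[of y] by simp
    qed
  qed
  then show ?thesis by simp
qed

lemma AE_reflect:
  assumes "AE x in lebesgue_on {0..s::real}. P x"
  shows "AE x in lebesgue_on {0..s}. P (s - x)"
proof -
  obtain N where N: "negligible N" "\<And>x. x \<in> {0..s} - N \<Longrightarrow> P x"
    using assms unfolding AE_lebesgue_on_iff_negligible by blast
  show ?thesis
  proof (rule AE_lebesgue_on_negligibleI)
    show "negligible ((\<lambda>x. s - x) ` N)"
      by (rule negligible_differentiable_image_negligible[OF _ N(1)])
        (auto intro!: derivative_intros)
    fix x assume x: "x \<in> {0..s}" "x \<notin> (\<lambda>x. s - x) ` N"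
    then have "s - x \<notin> N" by force
    then show "P (s - x)" using N(2)[of "s - x"] x by simp
  qed
qed

lemma ae_deriv_reflect:
  assumes "ae_deriv s f g"
  shows "ae_deriv s (\<lambda>x. f (s - x)) (\<lambda>x. - g (s - x))"
proof -
  obtain L where L: "L-lipschitz_on {0..s} f"
    using ae_deriv_lipschitz[OF assms] by blast
  have "L-lipschitz_on {0..s} (\<lambda>x. f (s - x))"
  proof (rule lipschitz_onI)
    show "0 \<le> L" using L by (rule lipschitz_on_nonneg)
    show "dist (f (s - x)) (f (s - y)) \<le> L * dist x y" if "x \<in> {0..s}" "y \<in> {0..s}" for x y
      using lipschitz_onD[OF L, of "s - x" "s - y"] that by (simp add: dist_real_def abs_minus_commute)
  qed
  moreover have "AE x in lebesgue_on {0..s}. ((\<lambda>x. f (s - x)) has_real_derivative - g (s - x)) (at x)"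
    using AE_reflect[OF ae_derivD[OF assms]]
  proof eventually_elim
    case (elim x)
    have "((\<lambda>x. s - x) has_real_derivative - 1) (at x)"
      by (auto intro!: derivative_eq_intros)
    from DERIV_chain2[OF elim this] show ?case by simp
  qed
  ultimately show ?thesis unfolding ae_deriv_def by blast
qed

lemma W1inf_reflect:
  assumes "f \<in> W1inf s" "0 < s"
  shows "(\<lambda>x. f (s - x)) \<in> W1inf s"
  using ae_deriv_imp_W1inf[OF ae_deriv_reflect[OF W1inf_imp_ae_deriv[OF assms]] assms(2)] .

lemma wderiv_reflect:
  assumes "f \<in> W1inf s" "0 < s"
  shows "AE x in lebesgue_on {0..s}. wderiv s (\<lambda>x. f (s - x)) x = - wderiv s f (s - x)"
  using ae_deriv_wderiv[OF ae_deriv_reflect[OF W1inf_imp_ae_deriv[OF assms]] assms(2)] .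

text \<open>
  Measurability of the reflected function comes for free from its being a derivative almost everywhere.
\<close>

lemma Linf_reflect:
  assumes "\<alpha> \<in> Linf s" "0 < s"
  shows "(\<lambda>x. - \<alpha> (s - x)) \<in> Linf s"
  using ae_deriv_Linf[OF ae_deriv_reflect[OF Linf_antiderivative[OF assms(1)]]] assms(2) by simp

text \<open>
  Reflection changes the sign of derivatives, and thereby turns the maximum with \<open>\<alpha>\<^sup>-\<close> into a minimum
  with \<open>- \<alpha>\<^sup>-\<close> and the terminal condition into an initial one.
\<close>

lemma backward_solution_reflect:
  assumes s: "0 < s" and \<mu>: "\<mu> \<in> W1inf s"
  shows "backward_solution s \<alpha> \<mu> \<phi> \<longleftrightarrow>
    forward_solution s (\<lambda>x. - \<alpha> (s - x)) (\<lambda>x. \<mu> (s - x)) (\<lambda>x. \<phi> (s - x))"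
proof -
  define b where "b x = (if \<mu> x \<le> \<phi> x then max (\<alpha> x) (wderiv s \<mu> x) else \<alpha> x)" for x
  define f where "f x = (if \<mu> (s - x) \<le> \<phi> (s - x)
    then min (- \<alpha> (s - x)) (wderiv s (\<lambda>x. \<mu> (s - x)) x) else - \<alpha> (s - x))" for x
  have bf: "AE x in lebesgue_on {0..s}. - b (s - x) = f x"
    using wderiv_reflect[OF \<mu> s] by eventually_elim (auto simp: b_def f_def min_def max_def)
  have fb: "AE x in lebesgue_on {0..s}. - f (s - x) = b x"
    using AE_reflect[OF bf] by eventually_elim simp
  have "ae_deriv s \<phi> b \<longleftrightarrow> ae_deriv s (\<lambda>x. \<phi> (s - x)) f"
  proof
    show "ae_deriv s (\<lambda>x. \<phi> (s - x)) f" if "ae_deriv s \<phi> b"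
      using ae_deriv_cong_AE[OF ae_deriv_reflect[OF that] bf] .
    show "ae_deriv s \<phi> b" if "ae_deriv s (\<lambda>x. \<phi> (s - x)) f"
      using ae_deriv_cong_AE[OF ae_deriv_reflect[OF that] fb] by simp
  qed
  then show ?thesis
    unfolding backward_solution_iff[OF s] forward_solution_iff[OF s] b_def[abs_def] f_def[abs_def] by simp
qed

lemma backward_solution_exists:
  assumes s: "0 < s" and \<alpha>: "\<alpha> \<in> Linf s" and \<mu>: "\<mu> \<in> W1inf s"
  shows "\<exists>\<phi>. backward_solution s \<alpha> \<mu> \<phi>"
proof -
  obtain \<psi> where "forward_solution s (\<lambda>x. - \<alpha> (s - x)) (\<lambda>x. \<mu> (s - x)) \<psi>"
    using forward_solution_exists[OF s Linf_reflect[OF \<alpha> s] W1inf_reflect[OF \<mu> s]] by blast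
  then have "backward_solution s \<alpha> \<mu> (\<lambda>x. \<psi> (s - x))"
    unfolding backward_solution_reflect[OF s \<mu>] by simp
  then show ?thesis by blast
qed

lemma backward_solution_le:
  assumes s: "0 < s" and \<mu>: "\<mu> \<in> W1inf s" and \<phi>: "backward_solution s \<alpha> \<mu> \<phi>" and x: "x \<in> {0..s}"
  shows "\<phi> x \<le> \<mu> x"
  using forward_solution_le[OF s W1inf_reflect[OF \<mu> s] \<phi>[unfolded backward_solution_reflect[OF s \<mu>]], of "s - x"] x
  by simp

lemma backward_solution_greatest:
  assumes s: "0 < s" and \<mu>: "\<mu> \<in> W1inf s" and \<phi>: "backward_solution s \<alpha> \<mu> \<phi>"
    and w: "ae_deriv s w w'" "\<And>y. y \<in> {0..s} \<Longrightarrow> w y \<le> \<mu> y" "AE y in lebesgue_on {0..s}. \<alpha> y \<le> w' y"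
    and x: "x \<in> {0..s}"
  shows "w x \<le> \<phi> x"
proof -
  have "AE y in lebesgue_on {0..s}. - w' (s - y) \<le> - \<alpha> (s - y)"
    using AE_reflect[OF w(3)] by eventually_elim simp
  moreover have "w (s - y) \<le> \<mu> (s - y)" if "y \<in> {0..s}" for y
    using w(2)[of "s - y"] that by simp
  ultimately show ?thesis
    using forward_solution_greatest[OF s W1inf_reflect[OF \<mu> s] \<phi>[unfolded backward_solution_reflect[OF s \<mu>]]
        ae_deriv_reflect[OF w(1)], of "s - x"] x
    by simp
qed

section \<open>The meet of the two solutions\<close>

text \<open>
  The strictly smaller of the two solutions is strictly below \<open>\<mu>\<close>, where its slope is \<open>\<alpha>p\<close> or \<open>\<alpha>m\<close>
  and the signs of these give the other bound.
\<close>

lemma meet_ae_deriv_between: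
  assumes s: "0 < s" and \<mu>: "\<mu> \<in> W1inf s"
    and sign: "AE x in lebesgue_on {0..s}. 0 \<le> \<alpha>p x" "AE x in lebesgue_on {0..s}. \<alpha>m x \<le> 0"
    and F: "forward_solution s \<alpha>p \<mu> F" and B: "backward_solution s \<alpha>m \<mu> B"
  shows "\<exists>g. ae_deriv s (\<lambda>x. min (F x) (B x)) g \<and>
    (AE x in lebesgue_on {0..s}. \<alpha>m x \<le> g x \<and> g x \<le> \<alpha>p x)"
proof -
  define F' where "F' x = (if \<mu> x \<le> F x then min (\<alpha>p x) (wderiv s \<mu> x) else \<alpha>p x)" for x
  define B' where "B' x = (if \<mu> x \<le> B x then max (\<alpha>m x) (wderiv s \<mu> x) else \<alpha>m x)" for x
  have F': "ae_deriv s F F'" and B': "ae_deriv s B B'"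
    using F B unfolding forward_solution_iff[OF s] backward_solution_iff[OF s] F'_def[abs_def] B'_def[abs_def] by auto
  have "AE x in lebesgue_on {0..s}. \<alpha>m x \<le> (if F x < B x then F' x else B' x) \<and>
      (if F x < B x then F' x else B' x) \<le> \<alpha>p x"
    using sign ae_deriv_eq_on_coincidence[OF F' B'] AE_lebesgue_on_interior
  proof eventually_elim
    case (elim x)
    have le: "F x \<le> \<mu> x" "B x \<le> \<mu> x"
      using forward_solution_le[OF s \<mu> F, of x] backward_solution_le[OF s \<mu> B, of x] elim(4) by auto
    consider "F x < B x" | "F x = B x" | "B x < F x" by linarith
    then show ?case
    proof cases
      case 1
      then have "F' x = \<alpha>p x" using le by (simp add: F'_def)
      then show ?thesis using 1 elim by simp
    next
      case 2
      have "F' x \<le> \<alpha>p x" "\<alpha>m x \<le> B' x" by (auto simp: F'_def B'_def)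
      then show ?thesis using 2 elim(3) by simp
    next
      case 3
      then have "B' x = \<alpha>m x" using le by (simp add: B'_def)
      then show ?thesis using 3 elim by simp
    qed
  qed
  then show ?thesis using ae_deriv_min[OF F' B'] by blast
qed

theorem theorem3p1:
  fixes s\<^sub>f :: real
    and \<mu>m \<mu>p \<alpha>m \<alpha>p :: "real \<Rightarrow> real"
    and \<Psi> :: "(real \<Rightarrow> real) \<Rightarrow> real"
  assumes "s\<^sub>f > 0"
    and "\<mu>m \<in> Linf s\<^sub>f" and "\<alpha>p \<in> Linf s\<^sub>f" and "\<alpha>m \<in> Linf s\<^sub>f"
    and "\<forall>x\<in>{0..s\<^sub>f}. \<mu>m x \<ge> 0"
    and "AE x in lebesgue_on {0..s\<^sub>f}. \<alpha>p x \<ge> 0"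
    and "AE x in lebesgue_on {0..s\<^sub>f}. \<alpha>m x \<le> 0"
    and "\<mu>p \<in> Q_set s\<^sub>f \<alpha>p \<alpha>m"
    and "order_reversing s\<^sub>f \<Psi>"
  shows "((\<exists>w. feasible s\<^sub>f \<mu>m \<mu>p \<alpha>m \<alpha>p w) \<longleftrightarrow>
           (\<forall>x\<in>{0..s\<^sub>f}. \<mu>m x \<le> meet_op s\<^sub>f \<alpha>p \<alpha>m \<mu>p x)) \<and>
         ((\<exists>w. feasible s\<^sub>f \<mu>m \<mu>p \<alpha>m \<alpha>p w) \<longrightarrow>
           feasible s\<^sub>f \<mu>m \<mu>p \<alpha>m \<alpha>p (meet_op s\<^sub>f \<alpha>p \<alpha>m \<mu>p) \<and>
           (\<forall>w. feasible s\<^sub>f \<mu>m \<mu>p \<alpha>m \<alpha>p w \<longrightarrow> \<Psi> (meet_op s\<^sub>f \<alpha>p \<alpha>m \<mu>p) \<le> \<Psi> w))"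
proof -
  have \<mu>p: "\<mu>p \<in> W1inf s\<^sub>f" using assms(8) unfolding Q_set_def by blast
  define F where "F = forward_op s\<^sub>f \<alpha>p \<mu>p"
  define B where "B = backward_op s\<^sub>f \<alpha>m \<mu>p"
  define W where "W = meet_op s\<^sub>f \<alpha>p \<alpha>m \<mu>p"
  have F: "forward_solution s\<^sub>f \<alpha>p \<mu>p F"
    unfolding F_def forward_op_def by (rule someI_ex[OF forward_solution_exists[OF assms(1,3) \<mu>p]])
  have B: "backward_solution s\<^sub>f \<alpha>m \<mu>p B"
    unfolding B_def backward_op_def by (rule someI_ex[OF backward_solution_exists[OF assms(1,4) \<mu>p]])
  have W: "W = (\<lambda>x. min (F x) (B x))"
    by (simp add: W_def F_def B_def meet_op_def)
  obtain g where g: "ae_deriv s\<^sub>f W g" "AE x in lebesgue_on {0..s\<^sub>f}. \<alpha>m x \<le> g x \<and> g x \<le> \<alpha>p x"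
    using meet_ae_deriv_between[OF assms(1) \<mu>p assms(6,7) F B] unfolding W by blast
  have W_W1inf: "W \<in> W1inf s\<^sub>f"
    by (rule ae_deriv_imp_W1inf[OF g(1) assms(1)])
  have W_deriv: "AE x in lebesgue_on {0..s\<^sub>f}. \<alpha>m x \<le> wderiv s\<^sub>f W x \<and> wderiv s\<^sub>f W x \<le> \<alpha>p x"
    using g(2) ae_deriv_wderiv[OF g(1) assms(1)] by eventually_elim simp
  have W_le: "W x \<le> \<mu>p x" if "x \<in> {0..s\<^sub>f}" for x
    using forward_solution_le[OF assms(1) \<mu>p F that] by (simp add: W)
  have W_feasible: "feasible s\<^sub>f \<mu>m \<mu>p \<alpha>m \<alpha>p W" if "\<forall>x\<in>{0..s\<^sub>f}. \<mu>m x \<le> W x"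
    using that W_W1inf W_deriv W_le unfolding feasible_def by blast
  have le_W: "w x \<le> W x" if w: "feasible s\<^sub>f \<mu>m \<mu>p \<alpha>m \<alpha>p w" and x: "x \<in> {0..s\<^sub>f}" for w x
  proof -
    have d: "ae_deriv s\<^sub>f w (wderiv s\<^sub>f w)"
      using w assms(1) W1inf_imp_ae_deriv unfolding feasible_def by blast
    have bounds: "AE x in lebesgue_on {0..s\<^sub>f}. wderiv s\<^sub>f w x \<le> \<alpha>p x"
      "AE x in lebesgue_on {0..s\<^sub>f}. \<alpha>m x \<le> wderiv s\<^sub>f w x"
      using w unfolding feasible_def by (auto elim: eventually_mono)
    have le: "w y \<le> \<mu>p y" if "y \<in> {0..s\<^sub>f}" for y
      using w that unfolding feasible_def by blast
    show ?thesis
      using forward_solution_greatest[OF assms(1) \<mu>p F d le bounds(1) x]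
        backward_solution_greatest[OF assms(1) \<mu>p B d le bounds(2) x] by (simp add: W)
  qed
  have "\<forall>x\<in>{0..s\<^sub>f}. \<mu>m x \<le> W x" if w: "feasible s\<^sub>f \<mu>m \<mu>p \<alpha>m \<alpha>p w" for w
  proof
    fix x assume x: "x \<in> {0..s\<^sub>f}"
    have "\<mu>m x \<le> w x" using w x unfolding feasible_def by blast
    then show "\<mu>m x \<le> W x" using le_W[OF w x] by simp
  qed
  moreover have "\<Psi> W \<le> \<Psi> w" if w: "feasible s\<^sub>f \<mu>m \<mu>p \<alpha>m \<alpha>p w" for w
    using assms(9) le_W[OF w] W_W1inf w unfolding order_reversing_def feasible_def by blast
  ultimately show ?thesis
    using W_feasible unfolding W_def[symmetric] by blast
qed

end
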